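(* Let $1\le r\le s\le t$ be integers with $t\ge 2$. As $n\to\infty$: (1) if $r=1$ or $s\le 2$, then $\mathrm{ex}(n,K_{r,s,t},2)=(3+o(1))\binom{n}{2}$; (2) if $r=2$ and $s\ge 3$, then $\mathrm{ex}(n,K_{2,s,t},2)=\left(\frac{13}{4}+o(1)\right)\binom{n}{2}$; (3) if $r\ge 3$, then $\mathrm{ex}(n,K_{r,s,t},2)=\left(\frac{7}{2}+o(1)\right)\binom{n}{2}$.
   Context: All graphs are finite and simple; $K_{r,s,t}$ is the complete tripartite graph with parts of sizes $r,s,t$. Let $n,q\ge 1$ be integers. For $\mathbf{x}\in\{0,1,\dots,q\}^n$ the support is $S_{\mathbf{x}}=\{i: x_i\neq 0\}$. Let $Q(n,2)=\{\mathbf{x}\in\{0,1,\dots,q\}^n: |S_{\mathbf{x}}|=2\}$; its elements are called $q$-edges, and a $q$-graph on $n$ vertices is a subset $H\subseteq Q(n,2)$. For a graph $F$ without isolated vertices and an integer $s'\ge1$, a $q$-graph $H$ is an $s'$-copy of $F$ if $|H|=|E(F)|$ and there is an isomorphism $\iota$ from $F$ to the graph with vertex set $\bigcup_{\mathbf{x}\in H}S_{\mathbf{x}}$ and edge set $\{S_{\mathbf{x}}:\mathbf{x}\in H\}$ such that, writing $\mathbf{x}^e$ for the unique element of $H$ with support $\iota(e)$, for all distinct $e,e'\in E(F)$ and $v\in e\cap e'$ we have $x^{e}_{\iota(v)}+x^{e'}_{\iota(v)}\ge s'$. A $q$-graph contains an $s'$-copy of $F$ if some subset of it is an $s'$-copy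 of $F$. $\mathrm{ex}(n,F,q)$ is the maximum of $|H|$ over all $H\subseteq Q(n,2)$ containing no $(q+1)$-copy of $F$ (here $q=2$). *)

theory Defs
  imports "HOL-Library.FuncSet" "HOL-Library.Landau_Symbols"
begin

text \<open>A graph is given by its vertex set and its set of (two-element) edges.\<close>

type_synonym 'a graph = "'a set \<times> 'a set set"

abbreviation verts :: "'a graph \<Rightarrow> 'a set" where "verts \<equiv> fst"
abbreviation edges :: "'a graph \<Rightarrow> 'a set set" where "edges \<equiv> snd"

definition simple_graph :: "'a graph \<Rightarrow> bool" where
  "simple_graph G \<longleftrightarrow> finite (verts G) \<and> (\<forall>e\<in>edges G. e \<subseteq> verts G \<and> card e = 2)"

definition graph_iso :: "('a \<Rightarrow> 'b) \<Rightarrow> 'a graph \<Rightarrow> 'b graph \<Rightarrow> bool" where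
  "graph_iso \<iota> F G \<longleftrightarrow>
     bij_betw \<iota> (verts F) (verts G) \<and>
     (\<forall>u\<in>verts F. \<forall>v\<in>verts F. {u, v} \<in> edges F \<longleftrightarrow> {\<iota> u, \<iota> v} \<in> edges G)"

text \<open>The vertices of part \<open>k \<in> {0, 1, 2}\<close> are the pairs with first component \<open>k\<close>.\<close>

definition tripartite_verts :: "nat \<Rightarrow> nat \<Rightarrow> nat \<Rightarrow> (nat \<times> nat) set" where
  "tripartite_verts r s t = {0} \<times> {..<r} \<union> {1} \<times> {..<s} \<union> {2} \<times> {..<t}"

definition complete_tripartite :: "nat \<Rightarrow> nat \<Rightarrow> nat \<Rightarrow> (nat \<times> nat) graph" where
  "complete_tripartite r s t =
     (tripartite_verts r s t,
      {{u, v} | u v. u \<in> tripartite_verts r s t \<and> v \<in> tripartite_verts r s t \<and> fst u \<noteq> fst v})"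

text \<open>
  The coordinates are indexed by \<open>{1..n}\<close>. Vectors are extensional functions (\<open>undefined\<close> outside
  \<open>{1..n}\<close>), so the support has to be restricted to this index set.
\<close>

type_synonym qvec = "nat \<Rightarrow> nat"

definition qvecs :: "nat \<Rightarrow> nat \<Rightarrow> qvec set" where
  "qvecs q n = {1..n} \<rightarrow>\<^sub>E {0..q}"

definition supp :: "nat \<Rightarrow> qvec \<Rightarrow> nat set" where
  "supp n x = {i \<in> {1..n}. x i \<noteq> 0}"

definition q_edges :: "nat \<Rightarrow> nat \<Rightarrow> qvec set" where
  "q_edges q n = {x \<in> qvecs q n. card (supp n x) = 2}"

definition underlying_graph :: "nat \<Rightarrow> qvec set \<Rightarrow> nat graph" where
  "underlying_graph n H = (\<Union>x\<in>H. supp n x, {supp n x | x. x \<in> H})"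

definition edge_with_supp :: "nat \<Rightarrow> qvec set \<Rightarrow> nat set \<Rightarrow> qvec" where
  "edge_with_supp n H A = (THE x. x \<in> H \<and> supp n x = A)"

text \<open>
  The notions below are meant for simple graphs \<open>F\<close> without isolated vertices. The condition on
  the cardinalities makes \<open>edge_with_supp n H (\<iota> ` e)\<close> well defined, see \<open>is_copy_unique\<close>.
  For \<open>edges F \<noteq> {}\<close> the maximum in \<open>ex_number\<close> exists, see \<open>ex_number_set\<close>.
\<close>

definition is_copy :: "nat \<Rightarrow> nat \<Rightarrow> 'a graph \<Rightarrow> qvec set \<Rightarrow> bool" where
  "is_copy n s' F H \<longleftrightarrow>
     card H = card (edges F) \<and>
     (\<exists>\<iota>. graph_iso \<iota> F (underlying_graph n H) \<and>
        (\<forall>e\<in>edges F. \<forall>e'\<in>edges F. e \<noteq> e' \<longrightarrow> (\<forall>v\<in>e \<inter> e'.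
           edge_with_supp n H (\<iota> ` e) (\<iota> v) + edge_with_supp n H (\<iota> ` e') (\<iota> v) \<ge> s')))"

definition contains_copy :: "nat \<Rightarrow> nat \<Rightarrow> 'a graph \<Rightarrow> qvec set \<Rightarrow> bool" where
  "contains_copy n s' F H \<longleftrightarrow> (\<exists>H'\<subseteq>H. is_copy n s' F H')"

definition ex_number :: "nat \<Rightarrow> 'a graph \<Rightarrow> nat \<Rightarrow> nat" where
  "ex_number n F q = Max {card H | H. H \<subseteq> q_edges q n \<and> \<not> contains_copy n (q + 1) F H}"

lemma is_copy_unique:
  assumes F: "simple_graph F" and H: "H \<subseteq> q_edges q n" "card H = card (edges F)"
    and iso: "graph_iso \<iota> F (underlying_graph n H)" and e: "e \<in> edges F"
  shows "\<exists>!x. x \<in> H \<and> supp n x = \<iota> ` e"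
proof -
  let ?E = "edges F"
  have finQ: "finite (q_edges q n)"
    by (simp add: q_edges_def qvecs_def finite_PiE)
  have finH: "finite H" using H(1) finQ finite_subset by blast
  have pair: "\<exists>u\<in>verts F. \<exists>v\<in>verts F. e = {u, v}" if "e \<in> ?E" for e
    using F that by (fastforce simp: simple_graph_def card_2_iff)
  have bij: "bij_betw \<iota> (verts F) (\<Union>x\<in>H. supp n x)"
    and adj: "\<And>u v. u \<in> verts F \<Longrightarrow> v \<in> verts F \<Longrightarrow>
        {u, v} \<in> ?E \<longleftrightarrow> {\<iota> u, \<iota> v} \<in> supp n ` H"
    using iso by (auto simp: graph_iso_def underlying_graph_def image_def Bex_def conj_commute eq_commute)
  have sub: "(`) \<iota> ` ?E \<subseteq> supp n ` H"
  proof
    fix A assume "A \<in> (`) \<iota> ` ?E"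
    then obtain e where "e \<in> ?E" "A = \<iota> ` e" by auto
    moreover obtain u v where "u \<in> verts F" "v \<in> verts F" "e = {u, v}"
      using pair calculation by blast
    ultimately show "A \<in> supp n ` H" using adj by auto
  qed
  have "inj_on ((`) \<iota>) ?E"
  proof (rule inj_on_subset[OF inj_on_image_Pow])
    show "inj_on \<iota> (verts F)" using bij by (simp add: bij_betw_def)
    show "?E \<subseteq> Pow (verts F)" using F by (auto simp: simple_graph_def)
  qed
  then have "card H \<le> card (supp n ` H)"
    using card_mono[OF finite_imageI[OF finH] sub] H(2) by (simp add: card_image)
  then have "inj_on (supp n) H"
    using finH by (simp add: card_image_le eq_card_imp_inj_on le_antisym)
  moreover have "\<iota> ` e \<in> supp n ` H" using sub e by blast
  ultimately show ?thesis by (auto simp: inj_on_def)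
qed

lemma ex_number_set:
  fixes F :: "'a graph" and n q :: nat
  assumes "finite (edges F)" "edges F \<noteq> {}"
  defines "S \<equiv> {card H | H. H \<subseteq> q_edges q n \<and> \<not> contains_copy n (q + 1) F H}"
  shows "finite S" "S \<noteq> {}"
proof -
  have "finite (q_edges q n)"
    by (simp add: q_edges_def qvecs_def finite_PiE)
  then show "finite S"
    unfolding S_def by (intro finite_subset[OF _ finite_imageI[of "Pow (q_edges q n)" card]]) auto
  have "\<not> contains_copy n (q + 1) F {}"
    using assms(1,2) by (auto simp: contains_copy_def is_copy_def)
  then show "S \<noteq> {}" unfolding S_def by blast
qed

lemma simple_graph_complete_tripartite: "simple_graph (complete_tripartite r s t)"
proof -
  have "card {u, v} = 2" if "fst u \<noteq> fst v" for u v :: "nat \<times> nat"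
    using that by (subst card_2_iff) blast
  moreover have "finite (tripartite_verts r s t)"
    by (simp add: tripartite_verts_def)
  ultimately show ?thesis
    by (auto simp only: simple_graph_def complete_tripartite_def fst_conv snd_conv mem_Collect_eq)
qed

end

theory Submission
  imports Defs
begin

text \<open>
  In a 3-copy, two edges at a common vertex cannot both have the entry 1 there. A vertex of the copy
  may therefore have the entry 1 on at most one of its edges. For a pair of vertices, the 2-edges
  present in a family form a set of types, a subset of \<open>{1, 2} \<times> {1, 2}\<close>, and the number of types is
  the weight of the pair. Weight 4 allows an edge without an entry 1; weight at least 3 allows to
  choose at which end an entry 1 may occur; weight 2 allows to confine it to one end, which is
  prescribed by the family. The extremal number is the largest total weight without a copy.

  Lower bounds come from splitting the vertices into two sets \<open>A\<close> and \<open>B\<close>, with weight 4 across and weight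
  3, namely all types but \<open>(2, 2)\<close>, within \<open>A\<close>. A set of vertices of the copy placed in \<open>A\<close> spans at most as
  many edges as vertices (\<open>penalised_edges_le_vertices\<close>). For density 3, \<open>B\<close> is empty. For density 7/2,
  the sets are halves and \<open>B\<close> is like \<open>A\<close>. For density 13/4, \<open>A\<close> contains three quarters of the vertices and \<open>B\<close>
  has only the type \<open>(1, 1)\<close>, so that a copy leaves a matching in \<open>B\<close>. A finite check shows that the
  graphs in question cannot be distributed in this way (\<open>split_family_copy_sizes\<close>).

  For the upper bounds, a family of density larger than \<open>c\<close> contains large blow-ups of weighted
  patterns on boundedly many vertices whose density is also larger than \<open>c\<close>
  (\<open>blow_up_of_dense_pattern\<close>, by averaging and the box theorem of Erdos). It remains to show that
  such a pattern contains one of a few small configurations, and that the blow-ups of these contain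
  the graph.

  For \<open>c = 7/2\<close> and \<open>c = 3\<close>, some edge of weight 4 has a third vertex with weights of sum more than
  \<open>2 * c\<close> to its ends, as otherwise such edges could be removed one after the other together with their
  ends (\<open>weight_le_if_full_edges_sparse\<close>). This gives a triangle with weights 4, 4, 4 or with
  weights 4, 4 and at least 3, respectively. In the blow-up of the latter, the edges of
  \<open>K\<^sub>1\<^sub>,\<^sub>s\<^sub>,\<^sub>t\<close> or \<open>K\<^sub>2\<^sub>,\<^sub>2\<^sub>,\<^sub>t\<close> that need an entry 1 form a star or a 4-cycle.

  For \<open>c = 13/4\<close>, the configurations are the triangle of weights 4 and the 4-cycle of weights 4 with
  both diagonals of weight at least 2; in the blow-up of this 4-cycle, the edges of \<open>K\<^sub>2\<^sub>,\<^sub>s\<^sub>,\<^sub>t\<close> that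
  need an entry 1 form two stars. That one of them occurs is the heart of the proof
  (\<open>low_degree_if_no_full_cycle\<close>): after passing to large minimum degree, one takes a vertex \<open>i\<close> in as many
  pairs of weight at most 1 as possible and compares its neighbourhood along edges of weight 4 with
  those of three of these neighbours.
\<close>

section \<open>Complete multipartite substructures of dense relations\<close>

lemma exists_large_fibre:
  assumes "finite G" "finite X" "X \<noteq> {}" "\<chi> ` G \<subseteq> X"
  shows "\<exists>x\<in>X. card G \<le> card X * card {f \<in> G. \<chi> f = x}"
proof (rule ccontr)
  assume "\<not> ?thesis"
  then have less: "card X * card {f \<in> G. \<chi> f = x} < card G" if "x \<in> X" for x
    using that by (meson not_le)
  have "card G = (\<Sum>x\<in>X. card {f \<in> G. \<chi> f = x})"
    using sum.group[OF assms(1,2,4), of "\<lambda>_. 1 :: nat"] by simp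
  then have "card X * card G = (\<Sum>x\<in>X. card X * card {f \<in> G. \<chi> f = x})"
    by (simp add: sum_distrib_left)
  also have "\<dots> < (\<Sum>x\<in>X. card G)"
    using assms less by (intro sum_strict_mono) auto
  finally show False by simp
qed

text \<open>A bipartite relation of positive density contains \<open>t\<close> left vertices with a positive proportion of
common right neighbours. It suffices to look at a set \<open>S\<close> of constantly many left vertices of large
degree: a positive proportion of the right vertices has at least \<open>t\<close> neighbours in \<open>S\<close>, and these
neighbourhoods fall into at most \<open>2 ^ card S\<close> classes. The new density depends on \<open>\<delta>\<close> and \<open>t\<close> only, so
that the lemma can be iterated.\<close>

lemma common_neighbours:
  fixes \<delta> :: real and t :: nat
  assumes "0 < \<delta>"
  shows "\<exists>\<delta>'>0. \<exists>N. \<forall>(A :: 'a set) (B :: 'b set) R.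
    finite A \<longrightarrow> finite B \<longrightarrow> N \<le> card A \<longrightarrow> R \<subseteq> A \<times> B \<longrightarrow>
    \<delta> * real (card A) * real (card B) \<le> real (card R) \<longrightarrow>
    (\<exists>T\<subseteq>A. card T = t \<and> \<delta>' * real (card B) \<le> real (card {b \<in> B. \<forall>a\<in>T. (a, b) \<in> R}))"
proof -
  \<comment> \<open>The size of the set \<open>S\<close>: vertices of \<open>B\<close> with fewer than
    \<open>t\<close> neighbours in \<open>S\<close> then account for at most half of the edges at
    \<open>S\<close>.\<close>
  define M where "M = nat \<lceil>4 * real t / \<delta>\<rceil> + 1"
  define \<delta>' where "\<delta>' = \<delta> / 4 / 2 ^ M"
  define N where "N = nat \<lceil>2 * real M / \<delta>\<rceil> + t + 1"
  have M: "M > 0" "4 * real t \<le> \<delta> * real M"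
  proof -
    have "4 * real t / \<delta> \<le> real M" unfolding M_def by linarith
    then show "4 * real t \<le> \<delta> * real M" using assms by (simp add: field_simps)
  qed (simp add: M_def)
  have N: "2 * real M \<le> \<delta> * real N" "N > 0"
  proof -
    have "2 * real M / \<delta> \<le> real N" unfolding N_def by linarith
    then show "2 * real M \<le> \<delta> * real N" using assms by (simp add: field_simps)
  qed (simp add: N_def)
  have "\<exists>T\<subseteq>A. card T = t \<and> \<delta>' * real (card B) \<le> real (card {b \<in> B. \<forall>a\<in>T. (a, b) \<in> R})"
    if fin: "finite A" "finite B" and NA: "N \<le> card A" and R: "R \<subseteq> A \<times> B"
      and dens: "\<delta> * real (card A) * real (card B) \<le> real (card R)" for A :: "'a set" and B :: "'b set" and R
  proof -
    define d where "d a = card {b \<in> B. (a, b) \<in> R}" for a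
    have d_le: "d a \<le> card B" for a unfolding d_def using fin by (intro card_mono) auto
    \<comment> \<open>The left vertices of at least half the average degree; they make up a \<open>\<delta>
      / 2\<close> proportion of \<open>A\<close>.\<close>
    define A' where "A' = {a \<in> A. \<delta> / 2 * real (card B) \<le> real (d a)}"
    have cardR: "card R = (\<Sum>a\<in>A. d a)"
    proof -
      have "card R = card (SIGMA a:A. {b \<in> B. (a, b) \<in> R})"
        using R by (intro arg_cong[where f = card]) auto
      also have "\<dots> = (\<Sum>a\<in>A. card {b \<in> B. (a, b) \<in> R})"
        using fin by (intro card_SigmaI) auto
      finally show ?thesis by (simp add: d_def)
    qed
    have "\<exists>S\<subseteq>A'. card S = M" if "card B > 0"
    proof -
      have "real (card R) = (\<Sum>a\<in>A'. real (d a)) + (\<Sum>a\<in>A-A'. real (d a))"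
        using fin unfolding cardR of_nat_sum by (subst sum.subset_diff[of A' A]) (auto simp: A'_def)
      also have "(\<Sum>a\<in>A'. real (d a)) \<le> (\<Sum>a\<in>A'. real (card B))"
        using d_le by (intro sum_mono) auto
      also have "(\<Sum>a\<in>A-A'. real (d a)) \<le> (\<Sum>a\<in>A-A'. \<delta> / 2 * real (card B))"
        by (intro sum_mono) (auto simp: A'_def)
      also have "\<dots> \<le> real (card A) * (\<delta> / 2 * real (card B))"
        using assms fin by (simp add: mult_right_mono card_mono)
      finally have "\<delta> * real (card A) * real (card B) \<le>
          real (card A') * real (card B) + real (card A) * (\<delta> / 2 * real (card B))"
        using dens by simp
      then have "(\<delta> / 2 * real (card A)) * real (card B) \<le> real (card A') * real (card B)"
        by (simp add: algebra_simps)
      then have "\<delta> / 2 * real (card A) \<le> real (card A')"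
        using that by simp
      moreover have "\<delta> * real N \<le> \<delta> * real (card A)" using NA assms by simp
      ultimately have "M \<le> card A'" using N by linarith
      then show ?thesis by (meson obtain_subset_with_card_n)
    qed
    show ?thesis
    proof (cases "card B = 0")
      case True
      have "t \<le> card A" using NA by (simp add: N_def)
      then obtain T where "T \<subseteq> A" "card T = t" by (meson obtain_subset_with_card_n)
      with True show ?thesis by auto
    next
      case False
      then obtain S where S: "S \<subseteq> A'" "card S = M" using \<open>card B > 0 \<Longrightarrow> _\<close> by auto
      then have SA: "S \<subseteq> A" "finite S" using fin by (auto simp: A'_def intro: finite_subset)
      define e where "e b = card {a \<in> S. (a, b) \<in> R}" for b
      define B' where "B' = {b \<in> B. t \<le> e b}"
      have "(\<Sum>a\<in>S. d a) = (\<Sum>b\<in>B. e b)"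
        unfolding d_def e_def using sum_multicount_gen[OF SA(2) fin(2), of "\<lambda>a b. (a, b) \<in> R" e] 
        by (simp add: e_def)
      moreover have "real M * (\<delta> / 2 * real (card B)) \<le> (\<Sum>a\<in>S. real (d a))"
        using sum_mono[of S "\<lambda>_. \<delta> / 2 * real (card B)" "\<lambda>a. real (d a)"] S by (auto simp: A'_def)
      ultimately have "real M * (\<delta> / 2 * real (card B)) \<le> (\<Sum>b\<in>B. real (e b))"
        by (metis of_nat_sum)
      also have "\<dots> = (\<Sum>b\<in>B'. real (e b)) + (\<Sum>b\<in>B-B'. real (e b))"
        using fin by (subst sum.subset_diff[of B' B]) (auto simp: B'_def)
      also have "(\<Sum>b\<in>B'. real (e b)) \<le> (\<Sum>b\<in>B'. real M)"
        using SA S(2) by (intro sum_mono) (auto simp: e_def intro!: card_mono)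
      also have "(\<Sum>b\<in>B-B'. real (e b)) \<le> (\<Sum>b\<in>B-B'. real t)"
        by (intro sum_mono) (auto simp: B'_def)
      also have "\<dots> \<le> real (card B) * real t"
        using fin by (simp add: mult_right_mono card_mono)
      also have "\<dots> \<le> real (card B) * (\<delta> * real M / 4)" using M by (intro mult_left_mono) auto
      finally have "real M * (\<delta> / 4 * real (card B)) \<le> real M * real (card B')"
        by (simp add: algebra_simps)
      then have B': "\<delta> / 4 * real (card B) \<le> real (card B')" using M by simp
      have "\<exists>T. T \<subseteq> {a \<in> S. (a, b) \<in> R} \<and> card T = t" if "b \<in> B'" for b
        using that unfolding B'_def e_def by (metis (lifting) mem_Collect_eq obtain_subset_with_card_n)
      then obtain \<chi> where \<chi>: "\<And>b. b \<in> B' \<Longrightarrow> \<chi> b \<subseteq> {a \<in> S. (a, b) \<in> R} \<and> card (\<chi> b) = t"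
        by metis
      define X where "X = {T \<in> Pow S. card T = t}"
      have X: "finite X" "card X \<le> 2 ^ M"
        using SA S card_mono[of "Pow S" X] by (auto simp: X_def card_Pow)
      have "finite B'" using fin by (auto simp: B'_def)
      have "0 < \<delta> / 4 * real (card B)" using False assms by simp
      then have "B' \<noteq> {}" using B' by auto
      then have "X \<noteq> {}" using \<chi> by (auto simp: X_def)
      moreover have "\<chi> ` B' \<subseteq> X" using \<chi> by (auto simp: X_def)
      ultimately obtain T where T: "T \<in> X" "card B' \<le> card X * card {b \<in> B'. \<chi> b = T}"
        using exists_large_fibre[OF \<open>finite B'\<close> X(1)] by blast
      have "card {b \<in> B'. \<chi> b = T} \<le> card {b \<in> B. \<forall>a\<in>T. (a, b) \<in> R}"
        using \<chi> fin by (intro card_mono) (auto simp: B'_def)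
      then have "card B' \<le> 2 ^ M * card {b \<in> B. \<forall>a\<in>T. (a, b) \<in> R}"
        using T(2) X(2) by (meson le_trans mult_le_mono)
      then have "real (card B') \<le> 2 ^ M * real (card {b \<in> B. \<forall>a\<in>T. (a, b) \<in> R})"
        by (metis (mono_tags) of_nat_le_iff of_nat_mult of_nat_numeral of_nat_power)
      then have "\<delta>' * real (card B) \<le> real (card {b \<in> B. \<forall>a\<in>T. (a, b) \<in> R})"
        using B' unfolding \<delta>'_def by (simp add: field_simps)
      then show ?thesis using T(1) SA by (auto simp: X_def)
    qed
  qed
  moreover have "\<delta>' > 0" using assms by (simp add: \<delta>'_def)
  ultimately show ?thesis by (intro exI[of _ \<delta>'] conjI exI[of _ N]) auto
qed

text \<open>The theorem of Erdos that a dense \<open>m\<close>-ary relation contains a complete \<open>m\<close>-partite one with parts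
of size \<open>t\<close>. The induction peels off the last coordinate: \<open>common_neighbours\<close>, applied with
all values of the remaining coordinates as right vertices, fixes a part for the last coordinate
that is compatible with a dense set of values of the others.\<close>

lemma box_theorem:
  fixes \<delta> :: real
  assumes "0 < \<delta>"
  shows "\<exists>N. \<forall>(V :: 'v set) G. finite V \<longrightarrow> N \<le> card V \<longrightarrow> G \<subseteq> ({..<m} \<rightarrow>\<^sub>E V) \<longrightarrow>
     \<delta> * real (card V) ^ m \<le> real (card G) \<longrightarrow>
     (\<exists>T. (\<forall>a<m. T a \<subseteq> V \<and> card (T a) = t) \<and> PiE {..<m::nat} T \<subseteq> G)"
  using assms
proof (induction m arbitrary: \<delta>)
  case 0
  have "PiE {} T \<subseteq> G" if "G \<subseteq> {\<lambda>_. undefined}" "\<delta> \<le> real (card G)"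
    for T :: "nat \<Rightarrow> 'v set" and G
    using that 0 by (cases "G = {}") auto
  then show ?case by auto
next
  case (Suc m)
  obtain \<delta>' N where \<delta>': "\<delta>' > 0" and N: "\<forall>(A :: 'v set) (B :: (nat \<Rightarrow> 'v) set) R.
    finite A \<longrightarrow> finite B \<longrightarrow> N \<le> card A \<longrightarrow> R \<subseteq> A \<times> B \<longrightarrow>
    \<delta> * real (card A) * real (card B) \<le> real (card R) \<longrightarrow>
    (\<exists>T\<subseteq>A. card T = t \<and> \<delta>' * real (card B) \<le> real (card {b \<in> B. \<forall>a\<in>T. (a, b) \<in> R}))"
    using common_neighbours[OF Suc.prems, of t] by (elim exE conjE) (rule that)
  obtain N' where N': "\<forall>(V :: 'v set) G. finite V \<longrightarrow> N' \<le> card V \<longrightarrow> G \<subseteq> ({..<m} \<rightarrow>\<^sub>E V) \<longrightarrow>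
     \<delta>' * real (card V) ^ m \<le> real (card G) \<longrightarrow>
     (\<exists>T. (\<forall>a<m. T a \<subseteq> V \<and> card (T a) = t) \<and> PiE {..<m} T \<subseteq> G)"
    using Suc.IH[OF \<delta>'] by (elim exE) (rule that)
  show ?case
  proof (intro exI[of _ "max N N'"] allI impI)
    fix V :: "'v set" and G
    assume V: "finite V" "max N N' \<le> card V" and G: "G \<subseteq> {..<Suc m} \<rightarrow>\<^sub>E V"
      and dens: "\<delta> * real (card V) ^ Suc m \<le> real (card G)"
    define B where "B = ({..<m} \<rightarrow>\<^sub>E V)"
    define R where "R = {(x, g). x \<in> V \<and> g \<in> B \<and> g(m := x) \<in> G}"
    have B: "finite B" "card B = card V ^ m" using V by (auto simp: B_def finite_PiE card_PiE)
    have ins: "({..<Suc m} \<rightarrow>\<^sub>E V) = (\<lambda>(y, g). g(m := y)) ` (V \<times> B)"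
      unfolding B_def lessThan_Suc by (rule PiE_insert_eq)
    have "card G \<le> card R"
    proof -
      have "G \<subseteq> (\<lambda>(y, g). g(m := y)) ` R" using G unfolding ins R_def by force
      moreover have "finite R" using V B by (auto simp: R_def intro: finite_subset[of _ "V \<times> B"])
      ultimately show ?thesis by (rule surj_card_le[rotated])
    qed
    then have "\<delta> * real (card V) * real (card B) \<le> real (card R)"
      using dens by (simp add: B mult.assoc)
    then obtain S where S: "S \<subseteq> V" "card S = t"
      "\<delta>' * real (card B) \<le> real (card {g \<in> B. \<forall>x\<in>S. (x, g) \<in> R})"
      using N[rule_format, of V B R] V B by (auto simp: R_def)
    moreover define G' where "G' = {g \<in> B. \<forall>x\<in>S. (x, g) \<in> R}"
    ultimately have "\<delta>' * real (card V) ^ m \<le> real (card G')" by (simp add: B)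
    moreover have "G' \<subseteq> {..<m} \<rightarrow>\<^sub>E V" by (auto simp: G'_def B_def)
    ultimately obtain T where T: "\<forall>a<m. T a \<subseteq> V \<and> card (T a) = t" "PiE {..<m} T \<subseteq> G'"
      using N' V by (meson max.boundedE)
    have "PiE {..<Suc m} (T(m := S)) \<subseteq> G"
    proof
      fix f assume "f \<in> PiE {..<Suc m} (T(m := S))"
      then obtain x g where f: "f = g(m := x)" "x \<in> S" "g \<in> PiE {..<m} (T(m := S))"
        unfolding lessThan_Suc PiE_insert_eq by auto
      moreover have "PiE {..<m} (T(m := S)) = PiE {..<m} T" by (intro PiE_cong) auto
      ultimately show "f \<in> G" using T(2) unfolding G'_def R_def by auto
    qed
    moreover have "\<forall>a<Suc m. (T(m := S)) a \<subseteq> V \<and> card ((T(m := S)) a) = t"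
      using T S by (auto simp: less_Suc_eq)
    ultimately show "\<exists>T. (\<forall>a<Suc m. T a \<subseteq> V \<and> card (T a) = t) \<and> PiE {..<Suc m} T \<subseteq> G" by blast
  qed
qed

section \<open>Blow-ups of dense patterns\<close>

lemma sum_PiE_insert:
  assumes "a \<notin> J"
  shows "(\<Sum>f\<in>insert a J \<rightarrow>\<^sub>E V. F f) = (\<Sum>x\<in>V. \<Sum>h\<in>J \<rightarrow>\<^sub>E V. F (h(a := x)))"
proof -
  have "(\<Sum>f\<in>insert a J \<rightarrow>\<^sub>E V. F f) = (\<Sum>p\<in>V \<times> (J \<rightarrow>\<^sub>E V). F (case p of (x, h) \<Rightarrow> h(a := x)))"
    unfolding PiE_insert_eq by (subst sum.reindex[OF inj_combinator[OF assms]]) (simp only: o_def)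
  also have "\<dots> = (\<Sum>(x, h)\<in>V \<times> (J \<rightarrow>\<^sub>E V). F (h(a := x)))"
    by (intro sum.cong) auto
  finally show ?thesis by (simp only: sum.cartesian_product)
qed

text \<open>Averaging over all maps from \<open>I\<close> to \<open>V\<close> sees each ordered pair of elements of \<open>V\<close> equally often at
each pair of distinct coordinates.\<close>

lemma sum_over_two_coordinates:
  fixes g :: "'v \<Rightarrow> 'v \<Rightarrow> nat"
  assumes "finite I" "a \<in> I" "b \<in> I" "a \<noteq> b" "finite V"
  shows "(\<Sum>f\<in>I \<rightarrow>\<^sub>E V. g (f a) (f b)) = card V ^ (card I - 2) * (\<Sum>x\<in>V. \<Sum>y\<in>V. g x y)"
proof -
  define J where "J = I - {a, b}"
  have I: "I = insert a (insert b J)" "a \<notin> insert b J" "b \<notin> J" using assms by (auto simp: J_def)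
  have J: "finite J" "card J = card I - 2" using assms by (auto simp: J_def card_Diff_subset)
  have "(\<Sum>f\<in>I \<rightarrow>\<^sub>E V. g (f a) (f b)) = (\<Sum>x\<in>V. \<Sum>h\<in>insert b J \<rightarrow>\<^sub>E V. g x (h b))"
    unfolding I(1) sum_PiE_insert[OF I(2)] using assms(4) by simp
  also have "\<dots> = (\<Sum>x\<in>V. \<Sum>y\<in>V. card V ^ card J * g x y)"
    unfolding sum_PiE_insert[OF I(3)] using J by (simp add: card_PiE)
  finally show ?thesis by (simp add: sum_distrib_left J)
qed

text \<open>This reduces an asymptotic density problem to weighted patterns on a constant number \<open>m\<close> of
vertices. A random map \<open>f\<close> from the \<open>m\<close> indices to \<open>V\<close> pulls \<open>\<tau>\<close> back to a pattern whose expected total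
weight is at least \<open>(c + \<epsilon>) * m * (m - 1)\<close>, which exceeds the threshold \<open>c * m ^ 2 + K * m\<close> by \<open>1\<close> if \<open>m\<close>
is large. As weights are bounded, a positive proportion of the maps yields patterns above the
threshold; one of the finitely many patterns is then yielded by a positive proportion of them, and
the box theorem gives parts on which this pattern is blown up.\<close>

lemma blow_up_of_dense_pattern:
  fixes c \<epsilon> K :: real and t :: nat and C :: "'c set" and wt :: "'c \<Rightarrow> nat"
  assumes C: "finite C" and eps: "0 < \<epsilon>" "0 \<le> c" "0 \<le> K" and wt: "\<forall>x\<in>C. wt x \<le> 4"
  shows "\<exists>m N. \<forall>(V :: 'v set) \<tau>. finite V \<longrightarrow> N \<le> card V \<longrightarrow> (\<forall>x\<in>V. \<forall>y\<in>V. \<tau> x y \<in> C) \<longrightarrow>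
    (c + \<epsilon>) * real (card V) ^ 2 \<le> real (\<Sum>x\<in>V. \<Sum>y\<in>V. wt (\<tau> x y)) \<longrightarrow>
    (\<exists>T P. (\<forall>a<m. T a \<subseteq> V \<and> card (T a) = t) \<and>
      (\<forall>a<m. \<forall>b<m. a \<noteq> b \<longrightarrow> (\<forall>x\<in>T a. \<forall>y\<in>T b. \<tau> x y = P a b)) \<and>
      (\<forall>a<m. \<forall>b<m. P a b \<in> C) \<and>
      c * real m ^ 2 + K * real m < real (\<Sum>a<m. \<Sum>b<m. if a = b then 0 else wt (P a b)))"
proof (cases "C = {}")
  case True
  have False if "card V \<ge> 1" "\<forall>x\<in>V. \<forall>y\<in>V. \<tau> x y \<in> C" for V :: "'v set" and \<tau>
    using that True by (cases "V = {}") auto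
  then show ?thesis by blast
next
  case nonempty: False
  \<comment> \<open>The gain \<open>\<epsilon> * m ^ 2\<close> has to beat the missing diagonal and the
    linear term of the threshold.\<close>
  define m where "m = nat \<lceil>(c + \<epsilon> + K + 1) / \<epsilon>\<rceil> + 1"
  define thr where "thr = c * real m ^ 2 + K * real m"
  have m1: "m \<ge> 1" by (simp add: m_def)
  have thr: "thr + 1 \<le> (c + \<epsilon>) * (real m * (real m - 1))" "0 \<le> thr"
  proof -
    have "(c + \<epsilon> + K + 1) / \<epsilon> \<le> real m" unfolding m_def by linarith
    then have "1 \<le> \<epsilon> * real m - (c + \<epsilon> + K)" using eps by (simp add: field_simps)
    then have "1 \<le> real m * (\<epsilon> * real m - (c + \<epsilon> + K))"
      using m1 mult_mono[of 1 "real m" 1 "\<epsilon> * real m - (c + \<epsilon> + K)"] by simp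
    then show "thr + 1 \<le> (c + \<epsilon>) * (real m * (real m - 1))"
      by (simp add: thr_def algebra_simps power2_eq_square)
    show "0 \<le> thr" using eps by (simp add: thr_def)
  qed
  define I where "I = {..<m}"
  define X where "X = (I \<times> I \<rightarrow>\<^sub>E C)"
  have X: "finite X" "X \<noteq> {}" using C nonempty by (auto simp: X_def I_def finite_PiE PiE_eq_empty_iff)
  define \<delta> where "\<delta> = 1 / (4 * real m ^ 2 * real (card X))"
  have "0 < \<delta>" using m1 X by (simp add: \<delta>_def card_gt_0_iff)
  obtain N where N: "\<forall>(V :: 'v set) G. finite V \<longrightarrow> N \<le> card V \<longrightarrow> G \<subseteq> ({..<m} \<rightarrow>\<^sub>E V) \<longrightarrow>
     \<delta> * real (card V) ^ m \<le> real (card G) \<longrightarrow>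
     (\<exists>T. (\<forall>a<m. T a \<subseteq> V \<and> card (T a) = t) \<and> PiE {..<m} T \<subseteq> G)"
    using box_theorem[OF \<open>0 < \<delta>\<close>, of m t] by (elim exE) (rule that)
  have "\<exists>T P. (\<forall>a<m. T a \<subseteq> V \<and> card (T a) = t) \<and>
      (\<forall>a<m. \<forall>b<m. a \<noteq> b \<longrightarrow> (\<forall>x\<in>T a. \<forall>y\<in>T b. \<tau> x y = P a b)) \<and>
      (\<forall>a<m. \<forall>b<m. P a b \<in> C) \<and>
      thr < real (\<Sum>a<m. \<Sum>b<m. if a = b then 0 else wt (P a b))"
    if V: "finite V" "max N 1 \<le> card V" and \<tau>: "\<And>x y. x \<in> V \<Longrightarrow> y \<in> V \<Longrightarrow> \<tau> x y \<in> C"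
      and dens: "(c + \<epsilon>) * real (card V) ^ 2 \<le> real (\<Sum>x\<in>V. \<Sum>y\<in>V. wt (\<tau> x y))"
    for V :: "'v set" and \<tau>
  proof -
    define \<Omega> where "\<Omega> = (I \<rightarrow>\<^sub>E V)"
    define n where "n = real (card V)"
    have n: "n \<ge> 1" using V by (simp add: n_def)
    have \<Omega>: "finite \<Omega>" "real (card \<Omega>) = n ^ m"
      using V by (auto simp: \<Omega>_def I_def finite_PiE card_PiE n_def)
    define W where "W = (\<Sum>x\<in>V. \<Sum>y\<in>V. wt (\<tau> x y))"
    define s where "s f = (\<Sum>a\<in>I. \<Sum>b\<in>I. if a = b then 0 else wt (\<tau> (f a) (f b)))" for f
    define G where "G = {f \<in> \<Omega>. thr < real (s f)}"
    have sum_s: "(\<Sum>f\<in>\<Omega>. s f) = m * (m - 1) * (card V ^ (m - 2) * W)"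
    proof -
      have "(\<Sum>f\<in>\<Omega>. s f) = (\<Sum>a\<in>I. \<Sum>b\<in>I. \<Sum>f\<in>\<Omega>. if a = b then 0 else wt (\<tau> (f a) (f b)))"
        unfolding s_def by (subst sum.swap, rule sum.cong[OF refl], subst sum.swap, rule refl)
      also have "\<dots> = (\<Sum>a\<in>I. \<Sum>b\<in>I. if a = b then 0 else card V ^ (m - 2) * W)"
        unfolding \<Omega>_def W_def
        using sum_over_two_coordinates[of I _ _ V "\<lambda>x y. wt (\<tau> x y)"] V
        by (intro sum.cong refl) (auto simp: I_def)
      also have "\<dots> = (\<Sum>a\<in>I. (m - 1) * (card V ^ (m - 2) * W))"
      proof (rule sum.cong[OF refl])
        fix a assume "a \<in> I"
        then have "(\<Sum>b\<in>I. if a = b then 0 else card V ^ (m - 2) * W) = (\<Sum>b\<in>I - {a}. card V ^ (m - 2) * W)"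
          by (intro sum.mono_neutral_cong_right) (auto simp: I_def)
        also have "\<dots> = (m - 1) * (card V ^ (m - 2) * W)" using \<open>a \<in> I\<close> by (simp add: I_def)
        finally show "(\<Sum>b\<in>I. if a = b then 0 else card V ^ (m - 2) * W) = (m - 1) * (card V ^ (m - 2) * W)" .
      qed
      finally show ?thesis by (simp add: I_def)
    qed
    \<comment> \<open>The maps in \<open>G\<close> contribute at most \<open>4 * m ^ 2\<close> each, the
      others at most \<open>thr\<close>, so \<open>G\<close> has to make up the surplus.\<close>
    have "(thr + 1) * n ^ m \<le> real (\<Sum>f\<in>\<Omega>. s f)"
    proof (cases "m = 1")
      case True
      then show ?thesis using thr by simp
    next
      case False
      define k where "k = m - 2"
      have k: "m = Suc (Suc k)" using m1 False by (simp add: k_def)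
      have "(thr + 1) * n ^ m \<le> (c + \<epsilon>) * (real m * (real m - 1)) * n ^ m"
        using mult_right_mono[OF thr(1), of "n ^ m"] n by simp
      also have "\<dots> = real m * (real m - 1) * (n ^ k * ((c + \<epsilon>) * n ^ 2))"
      proof -
        have "n ^ m = n ^ k * n ^ 2" by (simp add: k power2_eq_square)
        then show ?thesis by (simp only: mult_ac)
      qed
      also have "\<dots> \<le> real m * (real m - 1) * (n ^ k * real W)"
        using m1 n dens by (intro mult_left_mono) (auto simp: W_def n_def)
      also have "\<dots> = real (\<Sum>f\<in>\<Omega>. s f)"
        proof -
        have "m - 1 = Suc k" "m - 2 = k" "real m - 1 = real (Suc k)" using k by auto
        then show ?thesis unfolding sum_s n_def by (simp only: of_nat_mult of_nat_power mult.assoc)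
      qed
      finally show ?thesis .
    qed
    also have "real (\<Sum>f\<in>\<Omega>. s f) = (\<Sum>f\<in>G. real (s f)) + (\<Sum>f\<in>\<Omega> - G. real (s f))"
      unfolding of_nat_sum using \<Omega> by (subst sum.subset_diff[of G]) (auto simp: G_def)
    also have "(\<Sum>f\<in>G. real (s f)) \<le> (\<Sum>f\<in>G. 4 * real m ^ 2)"
    proof (rule sum_mono)
      fix f assume "f \<in> G"
      then have "f a \<in> V" if "a \<in> I" for a using that by (auto simp: G_def \<Omega>_def)
      then have "s f \<le> (\<Sum>a\<in>I. \<Sum>b\<in>I. 4)"
        unfolding s_def using wt \<tau> by (intro sum_mono) auto
      also have "\<dots> = 4 * m ^ 2" by (simp add: I_def power2_eq_square)
      finally show "real (s f) \<le> 4 * real m ^ 2"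
        by (metis (mono_tags) of_nat_le_iff of_nat_mult of_nat_numeral of_nat_power)
    qed
    also have "(\<Sum>f\<in>\<Omega> - G. real (s f)) \<le> (\<Sum>f\<in>\<Omega> - G. thr)"
      by (intro sum_mono) (auto simp: G_def)
    also have "\<dots> \<le> n ^ m * thr"
      using \<Omega> thr(2) card_mono[of \<Omega> "\<Omega> - G"] by (simp add: mult_right_mono flip: \<Omega>(2))
    finally have G_large: "n ^ m \<le> 4 * real m ^ 2 * real (card G)"
      by (simp add: algebra_simps)
    have "finite G" using \<Omega> by (auto simp: G_def)
    define \<chi> where "\<chi> f = (\<lambda>(a, b)\<in>I \<times> I. \<tau> (f a) (f b))" for f
    have "\<chi> ` G \<subseteq> X" using \<tau> unfolding G_def \<Omega>_def X_def \<chi>_def by (auto intro!: PiE_I \<tau> simp: PiE_mem)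
    then obtain p where p: "p \<in> X" "card G \<le> card X * card {f \<in> G. \<chi> f = p}"
      using exists_large_fibre[OF \<open>finite G\<close> X] by blast
    define G' where "G' = {f \<in> G. \<chi> f = p}"
    have "n ^ m \<le> 4 * real m ^ 2 * (real (card X) * real (card G'))"
    proof -
      have "real (card G) \<le> real (card X) * real (card G')"
        using p(2) unfolding G'_def of_nat_mult[symmetric] of_nat_le_iff .
      then have "4 * real m ^ 2 * real (card G) \<le> 4 * real m ^ 2 * (real (card X) * real (card G'))"
        by (intro mult_left_mono) auto
      with G_large show ?thesis by linarith
    qed
    then have "\<delta> * real (card V) ^ m \<le> real (card G')"
      using m1 X by (simp add: \<delta>_def n_def field_simps card_gt_0_iff)
    moreover have "G' \<subseteq> {..<m} \<rightarrow>\<^sub>E V" by (auto simp: G'_def G_def \<Omega>_def I_def)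
    ultimately obtain T where T: "\<forall>a<m. T a \<subseteq> V \<and> card (T a) = t" "PiE {..<m} T \<subseteq> G'"
      using N V by (meson max.boundedE)
    define P where "P a b = p (a, b)" for a b
    have \<chi>_P: "\<tau> (f a) (f b) = P a b" if "f \<in> G'" "a \<in> I" "b \<in> I" for f a b
      using that by (auto simp: G'_def \<chi>_def P_def restrict_def)
    have "\<tau> x y = P a b" if "a < m" "b < m" "a \<noteq> b" "x \<in> T a" "y \<in> T b" for a b x y
    proof -
      have "T c \<noteq> {}" if "c < m" for c
      proof -
        have "finite (T a)" using T(1) V(1) \<open>a < m\<close> by (auto intro: finite_subset)
        then have "card (T a) > 0" using \<open>x \<in> T a\<close> by (auto simp: card_gt_0_iff)
        moreover have "card (T c) = card (T a)" using T(1) that \<open>a < m\<close> by metis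
        ultimately show ?thesis by (metis card.empty less_irrefl)
      qed
      then have "\<forall>c. \<exists>z. c < m \<longrightarrow> z \<in> T c" by blast
      then obtain z where z: "\<And>c. c < m \<Longrightarrow> z c \<in> T c" by metis
      \<comment> \<open>Any pair of values at two distinct coordinates extends to an element of the
        box.\<close>
      define f where "f = (\<lambda>c\<in>{..<m}. if c = a then x else if c = b then y else z c)"
      have "f \<in> PiE {..<m} T" using z that by (auto simp: f_def)
      then have "\<tau> (f a) (f b) = P a b" using \<chi>_P T(2) that by (auto simp: I_def)
      then show ?thesis using that by (simp add: f_def)
    qed
    moreover have "\<forall>a<m. \<forall>b<m. P a b \<in> C" using p(1) by (auto simp: X_def P_def I_def)
    moreover have "thr < real (\<Sum>a<m. \<Sum>b<m. if a = b then 0 else wt (P a b))"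
    proof -
      have "card G' \<noteq> 0"
      proof
        assume "card G' = 0"
        then have "\<delta> * n ^ m \<le> 0"
          using \<open>\<delta> * real (card V) ^ m \<le> real (card G')\<close> by (simp add: n_def)
        moreover have "0 < \<delta> * n ^ m" using \<open>0 < \<delta>\<close> n by simp
        ultimately show False by linarith
      qed
      then obtain f where f: "f \<in> G'" by (metis card.empty ex_in_conv)
      then have "s f = (\<Sum>a<m. \<Sum>b<m. if a = b then 0 else wt (P a b))"
        unfolding s_def I_def using \<chi>_P[OF f] by (intro sum.cong refl) (auto simp: I_def)
      then show ?thesis using f by (simp add: G'_def G_def)
    qed
    ultimately show ?thesis using T(1) by (intro exI[of _ T] exI[of _ P]) blast
  qed
  note key = this
  show ?thesis
    by (rule exI[of _ m], rule exI[of _ "max N 1"], fold thr_def, intro allI impI, rule key) auto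
qed

section \<open>Total weights of patterns\<close>

text \<open>Removing the two ends of an edge of weight \<open>4\<close> costs at most \<open>p\<close> for each remaining vertex, which is
what the bound \<open>p / 2 * card S ^ 2\<close> allows; without such an edge all weights are at most \<open>3\<close>. For
\<open>p = 7\<close> this is the theorem of Mantel for the edges of weight \<open>4\<close>.\<close>

lemma weight_le_if_full_edges_sparse:
  fixes w :: "'a \<Rightarrow> 'a \<Rightarrow> nat"
  assumes S: "finite S" and sym: "\<And>i j. w i j = w j i" and refl: "\<And>i. w i i = 0"
    and le4: "\<And>i j. w i j \<le> 4" and p: "6 \<le> p"
    and sparse: "\<And>i j k. \<lbrakk>i \<in> S; j \<in> S; k \<in> S; w i j = 4; k \<noteq> i; k \<noteq> j\<rbrakk> \<Longrightarrow> w i k + w j k \<le> p"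
  shows "2 * (\<Sum>i\<in>S. \<Sum>j\<in>S. w i j) \<le> p * card S ^ 2"
  using S sparse
proof (induction "card S" arbitrary: S rule: less_induct)
  case less
  show ?case
  proof (cases "\<exists>i\<in>S. \<exists>j\<in>S. w i j = 4")
    case True
    then obtain i j where ij: "i \<in> S" "j \<in> S" "w i j = 4" by blast
    then have "i \<noteq> j" using refl by (metis zero_neq_numeral)
    define S' where "S' = S - {i, j}"
    have S: "S = insert i (insert j S')" "i \<notin> insert j S'" "j \<notin> S'" "finite S'"
      using ij less.prems \<open>i \<noteq> j\<close> by (auto simp: S'_def)
    then have card: "card S = card S' + 2" by simp
    have IH: "2 * (\<Sum>i\<in>S'. \<Sum>j\<in>S'. w i j) \<le> p * card S' ^ 2"
      using less.prems(2) S by (intro less.hyps) (auto simp: card)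
    have "(\<Sum>k\<in>S'. w i k + w j k) \<le> (\<Sum>k\<in>S'. p)"
      using less.prems(2)[OF ij(1,2)] ij(3) S by (intro sum_mono) auto
    then have "(\<Sum>k\<in>S'. w i k) + (\<Sum>k\<in>S'. w j k) \<le> p * card S'"
      by (simp add: sum.distrib mult.commute)
    moreover have "(\<Sum>k\<in>S'. w k i) = (\<Sum>k\<in>S'. w i k)" "(\<Sum>k\<in>S'. w k j) = (\<Sum>k\<in>S'. w j k)" "w j i = 4"
      using sym ij(3) by auto
    then have "(\<Sum>i\<in>S. \<Sum>j\<in>S. w i j) =
        (\<Sum>i\<in>S'. \<Sum>j\<in>S'. w i j) + 2 * ((\<Sum>k\<in>S'. w i k) + (\<Sum>k\<in>S'. w j k)) + 8"
      using S ij(3) by (simp add: refl sum.distrib)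
    ultimately show ?thesis using IH p unfolding card by (simp add: power2_eq_square algebra_simps)
  next
    case False
    have "(\<Sum>i\<in>S. \<Sum>j\<in>S. w i j) \<le> (\<Sum>i\<in>S. \<Sum>j\<in>S. 3)"
    proof (intro sum_mono)
      fix i j assume "i \<in> S" "j \<in> S"
      then have "w i j \<noteq> 4" using False by blast
      then show "w i j \<le> 3" using le4[of i j] by linarith
    qed
    also have "\<dots> = 3 * card S ^ 2" by (simp add: power2_eq_square)
    finally have "2 * (\<Sum>i\<in>S. \<Sum>j\<in>S. w i j) \<le> 6 * card S ^ 2" by simp
    also have "\<dots> \<le> p * card S ^ 2" using p by (intro mult_right_mono) auto
    finally show ?thesis .
  qed
qed

text \<open>Call the edges of weight \<open>4\<close> full and pairs of weight at most \<open>1\<close> light, and let \<open>m = card S\<close>. If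
all degrees exceed \<open>13 / 4 * m\<close>, then a vertex in \<open>l\<close> light pairs has more than \<open>m / 4 + 2 * l\<close>
full neighbours. Choose a vertex \<open>i\<close> that maximises \<open>l\<close>. Its more than \<open>2 * l + 2\<close> full neighbours
contain three that are pairwise not light. By the condition on 4-cycles, a common full neighbour
of two of them is \<open>i\<close> or forms a light pair with \<open>i\<close>. Hence, outside \<open>i\<close> and its light partners, the
full neighbourhoods of the three are disjoint, and they avoid the full neighbourhood of \<open>i\<close> as there
is no full triangle. Counting, these four neighbourhoods and the light partners of \<open>i\<close> need more
than \<open>4 * (m / 4) + 2 * l + l - 3 * l = m\<close> vertices.\<close>

lemma low_degree_if_no_full_cycle:
  fixes w :: "'a \<Rightarrow> 'a \<Rightarrow> nat"
  assumes S: "finite S" "S \<noteq> {}" and sym: "\<And>i j. w i j = w j i" and refl: "\<And>i. w i i = 0"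
    and le4: "\<And>i j. w i j \<le> 4"
    and triangle: "\<And>i j k. \<lbrakk>i \<in> S; j \<in> S; k \<in> S; w i j = 4; w i k = 4\<rbrakk> \<Longrightarrow> w j k \<noteq> 4"
    and cycle: "\<And>i j k l. \<lbrakk>i \<in> S; j \<in> S; k \<in> S; l \<in> S; w i j = 4; w j k = 4; w k l = 4; w l i = 4; 2 \<le> w i k\<rbrakk>
      \<Longrightarrow> w j l \<le> 1"
  shows "\<exists>i\<in>S. 4 * (\<Sum>j\<in>S. w i j) \<le> 13 * card S"
proof (rule ccontr)
  assume "\<not> ?thesis"
  then have deg: "13 * card S < 4 * (\<Sum>j\<in>S. w i j)" if "i \<in> S" for i using that by force
  \<comment> \<open>Full neighbours and light partners.\<close>
  define F where "F i = {j \<in> S. w i j = 4}" for i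
  define L where "L i = {j \<in> S. j \<noteq> i \<and> w i j \<le> 1}" for i
  have fin: "finite (F i)" "finite (L i)" for i using S by (auto simp: F_def L_def)
  \<comment> \<open>A vertex has degree at most \<open>3 * (card S - 1)\<close>, plus \<open>1\<close> for
    each full neighbour, minus \<open>2\<close> for each light partner.\<close>
  have F_large: "card S + 8 * card (L i) + 12 < 4 * card (F i)" if "i \<in> S" for i
  proof -
    have "(\<Sum>j\<in>S. w i j + (if j \<in> L i then 2 else 0) + (if j = i then 3 else 0)) \<le> (\<Sum>j\<in>S. 3 + (if j \<in> F i then 1 else 0))"
    proof (rule sum_mono)
      fix j assume "j \<in> S"
      then show "w i j + (if j \<in> L i then 2 else 0) + (if j = i then 3 else 0) \<le> 3 + (if j \<in> F i then 1 else 0)"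
        using le4[of i j] refl[of i] by (auto simp: L_def F_def)
    qed
    moreover have "S \<inter> L i = L i" "S \<inter> F i = F i" by (auto simp: L_def F_def)
    ultimately have "(\<Sum>j\<in>S. w i j) + 2 * card (L i) + 3 \<le> 3 * card S + card (F i)"
      using S that by (simp add: sum.distrib flip: sum.inter_restrict)
    then show ?thesis using deg[OF that] by linarith
  qed
  obtain i where i: "i \<in> S" and max: "\<And>j. j \<in> S \<Longrightarrow> card (L j) \<le> card (L i)"
  proof -
    have "Max ((\<lambda>j. card (L j)) ` S) \<in> (\<lambda>j. card (L j)) ` S" using S by (intro Max_in) auto
    then obtain i where "i \<in> S" "card (L i) = Max ((\<lambda>j. card (L j)) ` S)" by force
    then show ?thesis using S by (intro that[of i]) auto
  qed
  have FS: "F i \<subseteq> S" by (auto simp: F_def)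
  have heavy: "2 \<le> w j k" if "j \<in> S" "k \<in> S" "k \<noteq> j" "k \<notin> L j" for j k
    using that by (auto simp: L_def)
  have large: "2 * card (L i) + 3 \<le> card (F i)" using F_large[OF i] by linarith
  have "F i \<noteq> {}" using large by auto
  then obtain j1 where j1: "j1 \<in> F i" by blast
  have "\<not> F i \<subseteq> insert j1 (L j1)"
  proof
    assume "F i \<subseteq> insert j1 (L j1)"
    then have "card (F i) \<le> card (insert j1 (L j1))" using fin by (intro card_mono) auto
    also have "\<dots> \<le> card (L i) + 1" using max[of j1] j1 FS by (auto simp: card_insert_if fin)
    finally show False using large by linarith
  qed
  then obtain j2 where j2: "j2 \<in> F i" "j2 \<noteq> j1" "j2 \<notin> L j1" by blast
  have "\<not> F i \<subseteq> insert j1 (L j1) \<union> insert j2 (L j2)"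
  proof
    assume "F i \<subseteq> insert j1 (L j1) \<union> insert j2 (L j2)"
    then have "card (F i) \<le> card (insert j1 (L j1) \<union> insert j2 (L j2))" using fin by (intro card_mono) auto
    also have "\<dots> \<le> card (insert j1 (L j1)) + card (insert j2 (L j2))" by (rule card_Un_le)
    also have "\<dots> \<le> (card (L i) + 1) + (card (L i) + 1)"
      using max[of j1] max[of j2] j1 j2 FS by (intro add_mono) (auto simp: card_insert_if fin)
    finally show False using large by linarith
  qed
  then obtain j3 where j3: "j3 \<in> F i" "j3 \<noteq> j1" "j3 \<notin> L j1" "j3 \<noteq> j2" "j3 \<notin> L j2" by blast
  define X where "X j = F j - insert i (L i)" for j
  \<comment> \<open>The 4-cycle through \<open>j\<close>, \<open>i\<close>, \<open>k\<close> and a common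
    full neighbour \<open>l\<close> has the diagonals \<open>{j, k}\<close> and \<open>{i,
    l}\<close>.\<close>
  have disj: "X j \<inter> X k = {}" if "j \<in> F i" "k \<in> F i" "2 \<le> w j k" for j k
  proof -
    have "l \<in> insert i (L i)" if "l \<in> F j" "l \<in> F k" for l
      using cycle[of j i k l] that \<open>j \<in> F i\<close> \<open>k \<in> F i\<close> \<open>2 \<le> w j k\<close> i sym by (auto simp: F_def L_def)
    then show ?thesis by (auto simp: X_def)
  qed
  have Xsub: "X j \<subseteq> S - F i - L i" if "j \<in> F i" for j
    using triangle[of i j] that i by (auto simp: X_def F_def)
  have X_card: "card (F j) \<le> card (X j) + (card (L i) + 1)" for j
  proof -
    have "card (F j) \<le> card (X j \<union> insert i (L i))" using fin by (intro card_mono) (auto simp: X_def)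
    also have "\<dots> \<le> card (X j) + card (insert i (L i))" by (rule card_Un_le)
    also have "\<dots> \<le> card (X j) + (card (L i) + 1)" by (simp add: card_insert_if fin)
    finally show ?thesis .
  qed
  have "card (X j1) + card (X j2) + card (X j3) = card (X j1 \<union> X j2 \<union> X j3)"
  proof -
    have "finite (X j)" for j using fin by (simp add: X_def)
    moreover have "X j1 \<inter> X j2 = {}" using j1 j2 FS heavy by (intro disj) auto
    moreover have "X j1 \<inter> X j3 = {}" using j1 j3 FS heavy by (intro disj) auto
    moreover have "X j2 \<inter> X j3 = {}" using j2 j3 FS heavy by (intro disj) auto
    ultimately show ?thesis by (simp add: card_Un_disjoint Int_Un_distrib2)
  qed
  also have "\<dots> \<le> card (S - F i - L i)"
    using Xsub j1 j2 j3 S by (intro card_mono) auto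
  also have "\<dots> = card S - (card (F i) + card (L i))"
  proof -
    have "card (S - (F i \<union> L i)) = card S - card (F i \<union> L i)"
      using fin by (intro card_Diff_subset) (auto simp: F_def L_def)
    moreover have "card (F i \<union> L i) = card (F i) + card (L i)"
      using fin by (intro card_Un_disjoint) (auto simp: F_def L_def)
    ultimately show ?thesis by (simp add: Diff_Diff_Int Diff_Un Diff_eq Int_assoc)
  qed
  finally have "card (X j1) + card (X j2) + card (X j3) \<le> card S - (card (F i) + card (L i))" .
  moreover have "card (F i) + card (L i) \<le> card S"
  proof -
    have "card (F i \<union> L i) = card (F i) + card (L i)"
      using fin by (intro card_Un_disjoint) (auto simp: F_def L_def)
    moreover have "card (F i \<union> L i) \<le> card S" using S by (intro card_mono) (auto simp: F_def L_def)
    ultimately show ?thesis by simp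
  qed
  moreover have "j1 \<in> S" "j2 \<in> S" "j3 \<in> S" using j1 j2 j3 FS by auto
  ultimately show False
    using F_large[OF i] F_large[of j1] F_large[of j2] F_large[of j3] X_card[of j1] X_card[of j2] X_card[of j3]
    by linarith
qed

text \<open>Vertices of low degree are removed one by one. The linear term makes the bound drop by exactly
\<open>26 * card S\<close> in each step, which is what a vertex of low degree contributes.\<close>

lemma weight_le_if_no_full_cycle:
  fixes w :: "'a \<Rightarrow> 'a \<Rightarrow> nat"
  assumes S: "finite S" and sym: "\<And>i j. w i j = w j i" and refl: "\<And>i. w i i = 0"
    and le4: "\<And>i j. w i j \<le> 4"
    and triangle: "\<And>i j k. \<lbrakk>i \<in> S; j \<in> S; k \<in> S; w i j = 4; w i k = 4\<rbrakk> \<Longrightarrow> w j k \<noteq> 4"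
    and cycle: "\<And>i j k l. \<lbrakk>i \<in> S; j \<in> S; k \<in> S; l \<in> S; w i j = 4; w j k = 4; w k l = 4; w l i = 4; 2 \<le> w i k\<rbrakk>
      \<Longrightarrow> w j l \<le> 1"
  shows "4 * (\<Sum>i\<in>S. \<Sum>j\<in>S. w i j) \<le> 13 * card S ^ 2 + 13 * card S"
  using S triangle cycle
proof (induction S rule: finite_remove_induct)
  case empty
  then show ?case by simp
next
  case (remove S)
  have "\<exists>i\<in>S. 4 * (\<Sum>j\<in>S. w i j) \<le> 13 * card S"
    by (rule low_degree_if_no_full_cycle; fact remove.hyps sym refl le4 remove.prems)
  then obtain i where i: "i \<in> S" "4 * (\<Sum>j\<in>S. w i j) \<le> 13 * card S" by blast
  define S' where "S' = S - {i}"
  have S': "S = insert i S'" "i \<notin> S'" "finite S'" using i remove.hyps by (auto simp: S'_def)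
  have IH: "4 * (\<Sum>i\<in>S'. \<Sum>j\<in>S'. w i j) \<le> 13 * card S' ^ 2 + 13 * card S'"
    unfolding S'_def
  proof (rule remove.IH[OF i(1)])
    show "w b c \<noteq> 4" if "a \<in> S - {i}" "b \<in> S - {i}" "c \<in> S - {i}" "w a b = 4" "w a c = 4" for a b c
      using that remove.prems(1)[of a b c] by simp
    show "w b d \<le> 1" if "a \<in> S - {i}" "b \<in> S - {i}" "c \<in> S - {i}" "d \<in> S - {i}"
      "w a b = 4" "w b c = 4" "w c d = 4" "w d a = 4" "2 \<le> w a c" for a b c d
      using that remove.prems(2)[of a b c d] by simp
  qed
  have "(\<Sum>j\<in>S'. w j i) = (\<Sum>j\<in>S'. w i j)" using sym by auto
  then have "(\<Sum>i\<in>S. \<Sum>j\<in>S. w i j) = (\<Sum>i\<in>S'. \<Sum>j\<in>S'. w i j) + 2 * (\<Sum>j\<in>S. w i j)"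
    using S' by (simp add: refl sum.distrib)
  moreover have "card S = card S' + 1" using S' by simp
  ultimately show ?case using IH i(2) by (simp add: power2_eq_square algebra_simps)
qed

section \<open>Types of vertex pairs and copies\<close>

definition qvec_of :: "nat \<Rightarrow> nat \<Rightarrow> nat \<Rightarrow> nat \<Rightarrow> nat \<Rightarrow> qvec" where
  "qvec_of n x y p q = (\<lambda>k\<in>{1..n}. if k = x then p else if k = y then q else 0)"

text \<open>The type of a pair of vertices: the pairs of entries with which it occurs as a 2-edge of \<open>H\<close>, the
first entry belonging to \<open>x\<close>. The diagonal is empty, so that vertices joined by a nonempty type are
distinct.\<close>

definition labels :: "nat \<Rightarrow> qvec set \<Rightarrow> nat \<Rightarrow> nat \<Rightarrow> (nat \<times> nat) set" where
  "labels n H x y = (if x = y then {} else {(p, q) \<in> {1, 2} \<times> {1, 2}. qvec_of n x y p q \<in> H})"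

lemma qvec_of_app:
  "x \<in> {1..n} \<Longrightarrow> qvec_of n x y p q x = p"
  "y \<in> {1..n} \<Longrightarrow> x \<noteq> y \<Longrightarrow> qvec_of n x y p q y = q"
  by (auto simp: qvec_of_def)

lemma qvec_of_swap: "x \<noteq> y \<Longrightarrow> qvec_of n y x q p = qvec_of n x y p q"
  by (auto simp: qvec_of_def restrict_def)

lemma supp_qvec_of:
  "\<lbrakk>x \<in> {1..n}; y \<in> {1..n}; x \<noteq> y; p \<noteq> 0; q \<noteq> 0\<rbrakk> \<Longrightarrow> supp n (qvec_of n x y p q) = {x, y}"
  by (auto simp: supp_def qvec_of_def split: if_splits)

lemma qvec_of_in_q_edges:
  "\<lbrakk>x \<in> {1..n}; y \<in> {1..n}; x \<noteq> y; p \<in> {1, 2}; q \<in> {1, 2}\<rbrakk> \<Longrightarrow> qvec_of n x y p q \<in> q_edges 2 n"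
  using supp_qvec_of[of x n y p q] unfolding q_edges_def qvecs_def by (auto simp: qvec_of_def)

lemma finite_q_edges: "finite (q_edges q n)"
  by (simp add: q_edges_def qvecs_def finite_PiE)

lemma qvec_of_eq:
  assumes "z \<in> q_edges 2 n" "supp n z = {x, y}" "x \<noteq> y"
  shows "qvec_of n x y (z x) (z y) = z" "z x \<in> {1, 2}" "z y \<in> {1, 2}" "x \<in> {1..n}" "y \<in> {1..n}"
proof -
  have z: "z \<in> {1..n} \<rightarrow>\<^sub>E {0..2}" using assms(1) by (simp add: q_edges_def qvecs_def)
  show xy: "x \<in> {1..n}" "y \<in> {1..n}" using assms(2) by (auto simp: supp_def)
  have "z x \<noteq> 0" "z y \<noteq> 0" using assms(2) by (auto simp: supp_def)
  moreover have "z x \<le> 2" "z y \<le> 2" using z xy by (auto dest: PiE_mem)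
  ultimately show "z x \<in> {1, 2}" "z y \<in> {1, 2}" by auto
  show "qvec_of n x y (z x) (z y) = z"
  proof
    fix k
    have "k \<in> supp n z \<longleftrightarrow> k \<in> {x, y}" using assms(2) by simp
    then show "qvec_of n x y (z x) (z y) k = z k"
      using PiE_arb[OF z, of k] by (auto simp: qvec_of_def supp_def)
  qed
qed

lemma labels_subset: "labels n H x y \<subseteq> {1, 2} \<times> {1, 2}"
  by (auto simp: labels_def)

lemma finite_labels: "finite (labels n H x y)"
  by (rule finite_subset[OF labels_subset]) simp

lemma mem_labels_swap: "(p, q) \<in> labels n H x y \<longleftrightarrow> (q, p) \<in> labels n H y x"
  using qvec_of_swap[of x y n q p] by (auto simp: labels_def)

text \<open>Both sides count the pairs of a 2-edge in \<open>H\<close> and one of its two support vertices.\<close>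

lemma sum_card_labels:
  assumes "H \<subseteq> q_edges 2 n"
  shows "(\<Sum>x\<in>{1..n}. \<Sum>y\<in>{1..n}. card (labels n H x y)) = 2 * card H"
proof -
  define D where "D = (SIGMA (x, y):{1..n} \<times> {1..n}. labels n H x y)"
  define E where "E = (SIGMA z:H. supp n z)"
  have finH: "finite H" using assms finite_q_edges finite_subset by blast
  have "card D = (\<Sum>x\<in>{1..n}. \<Sum>y\<in>{1..n}. card (labels n H x y))"
    unfolding D_def by (subst card_SigmaI) (auto simp: finite_labels sum.cartesian_product case_prod_unfold)
  moreover have "card E = 2 * card H"
    unfolding E_def using assms finH
    by (subst card_SigmaI) (auto simp: q_edges_def supp_def subset_eq)
  moreover have "card D = card E"
  proof -
    let ?f = "\<lambda>((x, y), (p, q)). (qvec_of n x y p q, x)"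
    let ?g = "\<lambda>(z :: qvec, x). let y = (THE y. y \<in> supp n z \<and> y \<noteq> x) in ((x, y), (z x, z y))"
    have D: "supp n (qvec_of n x y p q) = {x, y}" "x \<noteq> y" "qvec_of n x y p q \<in> H"
      "qvec_of n x y p q x = p" "qvec_of n x y p q y = q"
      if "((x, y), (p, q)) \<in> D" for x y p q
      using that supp_qvec_of[of x n y p q] by (auto simp: D_def labels_def qvec_of_app split: if_splits)
    have other: "(THE y'. y' \<in> {x, y} \<and> y' \<noteq> x) = y" if "x \<noteq> y" for x y :: nat
      using that by (intro the_equality) auto
    have gf: "?g (?f a) = a" and fE: "?f a \<in> E" if "a \<in> D" for a
    proof -
      obtain x y p q where a: "a = ((x, y), (p, q))" by (metis surj_pair)
      note D = D[OF that[unfolded a]]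
      show "?g (?f a) = a" using other[OF D(2)] by (simp add: a D)
      show "?f a \<in> E" by (simp add: E_def a D)
    qed
    have E: "\<exists>y. supp n z = {x, y} \<and> x \<noteq> y \<and> z \<in> q_edges 2 n" if "(z, x) \<in> E" for z x
    proof -
      have "card (supp n z) = 2" "x \<in> supp n z" "z \<in> q_edges 2 n" using that assms by (auto simp: E_def q_edges_def)
      then show ?thesis by (auto simp: card_2_iff)
    qed
    have fg: "?f (?g a) = a" if "a \<in> E" for a
    proof -
      note \<open>a \<in> E\<close>
      moreover obtain z x where a: "a = (z, x)" by fastforce
      ultimately obtain y where y: "supp n z = {x, y}" "x \<noteq> y" "z \<in> q_edges 2 n" using E by blast
      then show "?f (?g a) = a"
        using other[of x y] qvec_of_eq(1)[of z n x y] by (simp add: Let_def a)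
    qed
    have gD: "?g a \<in> D" if "a \<in> E" for a
    proof -
      note \<open>a \<in> E\<close>
      moreover obtain z x where a: "a = (z, x)" by fastforce
      ultimately obtain y where y: "supp n z = {x, y}" "x \<noteq> y" "z \<in> q_edges 2 n" using E by blast
      have "z \<in> H" using \<open>a \<in> E\<close> by (auto simp: E_def a)
      then show "?g a \<in> D"
        using other[of x y] qvec_of_eq[of z n x y] y by (auto simp: Let_def D_def labels_def a)
    qed
    have "bij_betw ?f D E"
    proof (rule bij_betw_byWitness[where f' = ?g])
      show "\<forall>a\<in>D. ?g (?f a) = a" using gf by (rule ballI)
      show "\<forall>a\<in>E. ?f (?g a) = a" using fg by (rule ballI)
      show "?f ` D \<subseteq> E" using fE by (rule image_subsetI)
      show "?g ` E \<subseteq> D" using gD by (rule image_subsetI)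
    qed
    then show ?thesis by (rule bij_betw_same_card)
  qed
  ultimately show ?thesis by simp
qed

text \<open>A copy is given by an injection \<open>\<iota>\<close> together with a choice \<open>X e\<close> of a \<open>q\<close>-edge over the image of each
edge \<open>e\<close>; this lemma and the next one replace the isomorphism with the underlying graph by such
data.\<close>

lemma contains_copyI:
  assumes F: "simple_graph F" "\<Union>(edges F) = verts F" and inj: "inj_on \<iota> (verts F)"
    and X: "\<And>e. e \<in> edges F \<Longrightarrow> X e \<in> H \<and> supp n (X e) = \<iota> ` e"
    and lab: "\<And>e e' v. \<lbrakk>e \<in> edges F; e' \<in> edges F; e \<noteq> e'; v \<in> e; v \<in> e'\<rbrakk> \<Longrightarrow> s' \<le> X e (\<iota> v) + X e' (\<iota> v)"
  shows "contains_copy n s' F H"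
proof -
  have sub: "e \<subseteq> verts F" if "e \<in> edges F" for e using F that by (auto simp: simple_graph_def)
  have img_inj: "e = e'" if "e \<subseteq> verts F" "e' \<subseteq> verts F" "\<iota> ` e = \<iota> ` e'" for e e'
    using inj that by (simp add: inj_on_image_eq_iff)
  define H' where "H' = X ` edges F"
  have "inj_on X (edges F)" using X sub img_inj by (metis inj_onI)
  then have card: "card H' = card (edges F)" by (simp add: H'_def card_image)
  have supps: "{supp n x |x. x \<in> H'} = (`) \<iota> ` edges F" using X by (force simp: H'_def)
  have ews: "edge_with_supp n H' (\<iota> ` e) = X e" if "e \<in> edges F" for e
    unfolding edge_with_supp_def
  proof (rule the_equality)
    show "X e \<in> H' \<and> supp n (X e) = \<iota> ` e" using X that by (auto simp: H'_def)
    fix x assume "x \<in> H' \<and> supp n x = \<iota> ` e"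
    then obtain e' where e': "e' \<in> edges F" "x = X e'" "\<iota> ` e' = \<iota> ` e" using X by (auto simp: H'_def)
    then show "x = X e" using img_inj[OF sub[OF e'(1)] sub[OF that] e'(3)] by simp
  qed
  have "graph_iso \<iota> F (underlying_graph n H')"
    unfolding graph_iso_def underlying_graph_def fst_conv snd_conv supps
  proof (intro conjI ballI)
    have "(\<Union>x\<in>H'. supp n x) = \<iota> ` \<Union>(edges F)" using X by (auto simp: H'_def)
    then show "bij_betw \<iota> (verts F) (\<Union>x\<in>H'. supp n x)" using inj F(2) by (simp add: bij_betw_def)
    fix u v assume uv: "u \<in> verts F" "v \<in> verts F"
    show "{u, v} \<in> edges F \<longleftrightarrow> {\<iota> u, \<iota> v} \<in> (`) \<iota> ` edges F"
    proof
      assume "{u, v} \<in> edges F"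
      then have "\<iota> ` {u, v} \<in> (`) \<iota> ` edges F" by (rule imageI)
      then show "{\<iota> u, \<iota> v} \<in> (`) \<iota> ` edges F" by simp
    next
      assume "{\<iota> u, \<iota> v} \<in> (`) \<iota> ` edges F"
      then obtain e where e: "e \<in> edges F" "\<iota> ` {u, v} = \<iota> ` e" by auto
      then have "{u, v} = e" using uv sub by (intro img_inj) auto
      then show "{u, v} \<in> edges F" using e by simp
    qed
  qed
  moreover have "\<forall>e\<in>edges F. \<forall>e'\<in>edges F. e \<noteq> e' \<longrightarrow> (\<forall>v\<in>e \<inter> e'.
      s' \<le> edge_with_supp n H' (\<iota> ` e) (\<iota> v) + edge_with_supp n H' (\<iota> ` e') (\<iota> v))"
    using lab by (simp add: ews)
  ultimately have "is_copy n s' F H'" unfolding is_copy_def using card by blast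
  moreover have "H' \<subseteq> H" using X by (auto simp: H'_def)
  ultimately show ?thesis by (auto simp: contains_copy_def)
qed

lemma contains_copyE:
  assumes "contains_copy n s' F H" "simple_graph F" "H \<subseteq> q_edges q n"
  obtains \<iota> X where "inj_on \<iota> (verts F)" "\<iota> ` verts F \<subseteq> {1..n}" "\<And>e. e \<in> edges F \<Longrightarrow> X e \<in> H \<and> supp n (X e) = \<iota> ` e"
    "\<And>e e' v. \<lbrakk>e \<in> edges F; e' \<in> edges F; e \<noteq> e'; v \<in> e; v \<in> e'\<rbrakk> \<Longrightarrow> s' \<le> X e (\<iota> v) + X e' (\<iota> v)"
proof -
  obtain H' \<iota> where H': "H' \<subseteq> H" "card H' = card (edges F)" and iso: "graph_iso \<iota> F (underlying_graph n H')"
    and lab: "\<forall>e\<in>edges F. \<forall>e'\<in>edges F. e \<noteq> e' \<longrightarrow> (\<forall>v\<in>e \<inter> e'.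
           edge_with_supp n H' (\<iota> ` e) (\<iota> v) + edge_with_supp n H' (\<iota> ` e') (\<iota> v) \<ge> s')"
    using assms(1) by (auto simp: contains_copy_def is_copy_def)
  show ?thesis
  proof (rule that[of \<iota> "\<lambda>e. edge_with_supp n H' (\<iota> ` e)"])
    show "inj_on \<iota> (verts F)" using iso by (simp add: graph_iso_def bij_betw_def)
    show "\<iota> ` verts F \<subseteq> {1..n}"
      using iso by (auto simp: graph_iso_def bij_betw_def underlying_graph_def supp_def)
    show "edge_with_supp n H' (\<iota> ` e) \<in> H \<and> supp n (edge_with_supp n H' (\<iota> ` e)) = \<iota> ` e"
      if "e \<in> edges F" for e
    proof -
      have "H' \<subseteq> q_edges q n" using H'(1) assms(3) by blast
      from theI'[OF is_copy_unique[OF assms(2) this H'(2) iso that]]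
      show ?thesis using H'(1) by (auto simp: edge_with_supp_def)
    qed
    show "s' \<le> edge_with_supp n H' (\<iota> ` e) (\<iota> v) + edge_with_supp n H' (\<iota> ` e') (\<iota> v)"
      if "e \<in> edges F" "e' \<in> edges F" "e \<noteq> e'" "v \<in> e" "v \<in> e'" for e e' v
      using lab that by simp
  qed
qed

lemma edges_complete_tripartite:
  "e \<in> edges (complete_tripartite r s t) \<longleftrightarrow>
     (\<exists>u\<in>tripartite_verts r s t. \<exists>v\<in>tripartite_verts r s t. fst u < fst v \<and> e = {u, v})"
proof
  assume "e \<in> edges (complete_tripartite r s t)"
  then obtain u v where "u \<in> tripartite_verts r s t" "v \<in> tripartite_verts r s t" "fst u \<noteq> fst v" "e = {u, v}"
    by (auto simp: complete_tripartite_def)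
  then show "\<exists>u\<in>tripartite_verts r s t. \<exists>v\<in>tripartite_verts r s t. fst u < fst v \<and> e = {u, v}"
    by (metis insert_commute linorder_neq_iff)
next
  assume "\<exists>u\<in>tripartite_verts r s t. \<exists>v\<in>tripartite_verts r s t. fst u < fst v \<and> e = {u, v}"
  then obtain u v where "e = {u, v} \<and> u \<in> tripartite_verts r s t \<and> v \<in> tripartite_verts r s t \<and> fst u \<noteq> fst v"
    by (metis less_irrefl)
  then show "e \<in> edges (complete_tripartite r s t)"
    unfolding complete_tripartite_def snd_conv mem_Collect_eq by (intro exI)
qed

lemma edge_complete_tripartiteI:
  "\<lbrakk>u \<in> tripartite_verts r s t; v \<in> tripartite_verts r s t; fst u \<noteq> fst v\<rbrakk> \<Longrightarrow>
    {u, v} \<in> edges (complete_tripartite r s t)"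
  unfolding complete_tripartite_def snd_conv by (intro CollectI exI[of _ u] exI[of _ v]) simp

lemma Union_edges_complete_tripartite:
  assumes "1 \<le> r" "1 \<le> s" "1 \<le> t"
  shows "\<Union>(edges (complete_tripartite r s t)) = verts (complete_tripartite r s t)"
proof -
  have "\<exists>v\<in>tripartite_verts r s t. fst u \<noteq> fst v" if "u \<in> tripartite_verts r s t" for u
  proof (cases "fst u = 0")
    case True
    then show ?thesis using assms by (intro bexI[of _ "(1, 0)"]) (auto simp: tripartite_verts_def)
  next
    case False
    then show ?thesis using assms by (intro bexI[of _ "(0, 0)"]) (auto simp: tripartite_verts_def)
  qed
  then have "\<exists>v. {u, v} \<in> edges (complete_tripartite r s t)" if "u \<in> tripartite_verts r s t" for u
    using that unfolding complete_tripartite_def snd_conv mem_Collect_eq by metis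
  then have "tripartite_verts r s t \<subseteq> \<Union>(edges (complete_tripartite r s t))" by blast
  moreover have "\<Union>(edges (complete_tripartite r s t)) \<subseteq> tripartite_verts r s t"
    by (auto simp: complete_tripartite_def)
  ultimately show ?thesis by (auto simp: complete_tripartite_def)
qed

text \<open>Two 2-edges at a common vertex violate the condition on copies only if both have the entry \<open>1\<close>
there. So in a 3-copy each vertex \<open>v\<close> may have the entry \<open>1\<close> on at most one edge, and \<open>par v\<close> is the
other end of this edge. A vertex that never needs the entry \<open>1\<close> can have an arbitrary value \<open>par v\<close>.\<close>

lemma contains_tripartiteI:
  assumes pos: "1 \<le> r" "1 \<le> s" "1 \<le> t" and inj: "inj_on \<iota> (tripartite_verts r s t)"
    and img: "\<iota> ` tripartite_verts r s t \<subseteq> {1..n}"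
    and lab: "\<And>u v. \<lbrakk>u \<in> tripartite_verts r s t; v \<in> tripartite_verts r s t; fst u < fst v\<rbrakk> \<Longrightarrow>
      \<exists>(p, q) \<in> labels n H (\<iota> u) (\<iota> v). (p = 2 \<or> par u = v) \<and> (q = 2 \<or> par v = u)"
  shows "contains_copy n 3 (complete_tripartite r s t) H"
proof -
  let ?F = "complete_tripartite r s t"
  have "\<exists>x\<in>H. supp n x = \<iota> ` e \<and> (\<forall>v\<in>e. 1 \<le> x (\<iota> v) \<and> (x (\<iota> v) = 2 \<or> e = {v, par v}))"
    if "e \<in> edges ?F" for e
  proof -
    obtain u v where uv: "u \<in> tripartite_verts r s t" "v \<in> tripartite_verts r s t" "fst u < fst v" "e = {u, v}"
      using \<open>e \<in> edges ?F\<close> by (auto simp: edges_complete_tripartite)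
    obtain p q where pq: "(p, q) \<in> labels n H (\<iota> u) (\<iota> v)" "p = 2 \<or> par u = v" "q = 2 \<or> par v = u"
      using lab[OF uv(1-3)] by auto
    have n: "\<iota> u \<in> {1..n}" "\<iota> v \<in> {1..n}" using img uv by auto
    have neq: "\<iota> u \<noteq> \<iota> v" using inj uv by (auto simp: inj_on_def)
    have x: "qvec_of n (\<iota> u) (\<iota> v) p q \<in> H" "p \<in> {1, 2}" "q \<in> {1, 2}"
      using pq neq by (auto simp: labels_def)
    show ?thesis
      using x pq(2,3) uv(4) qvec_of_app[OF n(1), of "\<iota> v" p q] qvec_of_app(2)[OF n(2) neq, of p q]
        supp_qvec_of[OF n neq, of p q]
      by (intro bexI[OF _ x(1)]) (auto simp: insert_commute)
  qed
  then obtain X where X: "\<And>e. e \<in> edges ?F \<Longrightarrow> X e \<in> H \<and> supp n (X e) = \<iota> ` e \<and>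
      (\<forall>v\<in>e. 1 \<le> X e (\<iota> v) \<and> (X e (\<iota> v) = 2 \<or> e = {v, par v}))"
    by metis
  show ?thesis
  proof (rule contains_copyI)
    show "simple_graph ?F" by (rule simple_graph_complete_tripartite)
    show "\<Union>(edges ?F) = verts ?F" by (rule Union_edges_complete_tripartite[OF pos])
    show "inj_on \<iota> (verts ?F)" using inj by (simp add: complete_tripartite_def)
    show "X e \<in> H \<and> supp n (X e) = \<iota> ` e" if "e \<in> edges ?F" for e using X[OF that] by blast
    fix e e' v assume "e \<in> edges ?F" "e' \<in> edges ?F" "e \<noteq> e'" "v \<in> e" "v \<in> e'"
    then have "1 \<le> X e (\<iota> v)" "1 \<le> X e' (\<iota> v)" "X e (\<iota> v) = 2 \<or> X e' (\<iota> v) = 2"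
      using X[of e] X[of e'] by blast+
    then show "3 \<le> X e (\<iota> v) + X e' (\<iota> v)" by linarith
  qed
qed

section \<open>Constructions\<close>

lemma finite_edges: "simple_graph F \<Longrightarrow> finite (edges F)"
  by (rule finite_subset[of _ "Pow (verts F)"]) (auto simp: simple_graph_def)

lemma edges_complete_tripartite_nonempty:
  assumes "1 \<le> r" "1 \<le> s"
  shows "edges (complete_tripartite r s t) \<noteq> {}"
proof -
  have "{(0, 0), (1, 0)} \<in> edges (complete_tripartite r s t)"
    unfolding edges_complete_tripartite using assms
    by (intro bexI[of _ "(0, 0)"] bexI[of _ "(1, 0)"]) (auto simp: tripartite_verts_def)
  then show ?thesis by blast
qed

lemma card_le_ex_number:
  assumes "finite (edges F)" "edges F \<noteq> {}" "H \<subseteq> q_edges q n" "\<not> contains_copy n (q + 1) F H"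
  shows "card H \<le> ex_number n F q"
proof -
  have "card H \<in> {card H | H. H \<subseteq> q_edges q n \<and> \<not> contains_copy n (q + 1) F H}"
    using assms(3,4) by blast
  then show ?thesis unfolding ex_number_def by (rule Max_ge[OF ex_number_set(1)[OF assms(1,2)]])
qed

lemma ex_number_attained:
  assumes "finite (edges F)" "edges F \<noteq> {}"
  obtains H where "H \<subseteq> q_edges q n" "\<not> contains_copy n (q + 1) F H" "card H = ex_number n F q"
proof -
  have "ex_number n F q \<in> {card H | H. H \<subseteq> q_edges q n \<and> \<not> contains_copy n (q + 1) F H}"
    unfolding ex_number_def using ex_number_set[OF assms, of q n] by (rule Max_in)
  then show ?thesis using that by auto
qed

text \<open>The vertices are split into \<open>A\<close> and its complement. All 2-edges across are present, those within \<open>A\<close>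
must have an entry \<open>1\<close>, and those within the complement are restricted to the types in \<open>L\<close>.\<close>

definition split_family :: "nat \<Rightarrow> nat set \<Rightarrow> (nat \<times> nat) set \<Rightarrow> qvec set" where
  "split_family n A L = {z \<in> q_edges 2 n. \<forall>x y. supp n z = {x, y} \<and> x \<noteq> y \<longrightarrow>
     (x \<in> A \<and> y \<in> A \<longrightarrow> (z x, z y) \<noteq> (2, 2)) \<and> (x \<notin> A \<and> y \<notin> A \<longrightarrow> (z x, z y) \<in> L)}"

lemma split_family_q_edges: "split_family n A L \<subseteq> q_edges 2 n"
  by (auto simp: split_family_def)

lemma labels_split_family:
  assumes xy: "x \<in> {1..n}" "y \<in> {1..n}" "x \<noteq> y" and sym: "\<And>p q. (p, q) \<in> L \<longleftrightarrow> (q, p) \<in> L"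
  shows "labels n (split_family n A L) x y =
    (if x \<in> A \<and> y \<in> A then {1, 2} \<times> {1, 2} - {(2, 2)}
     else if x \<notin> A \<and> y \<notin> A then L \<inter> ({1, 2} \<times> {1, 2}) else {1, 2} \<times> {1, 2})" (is "_ = ?R")
proof -
  have iff: "(p, q) \<in> labels n (split_family n A L) x y \<longleftrightarrow> (p, q) \<in> ?R" if pq: "p \<in> {1, 2}" "q \<in> {1, 2}" for p q
  proof -
    let ?z = "qvec_of n x y p q"
    have z: "?z \<in> q_edges 2 n" "supp n ?z = {x, y}" "?z x = p" "?z y = q"
      using qvec_of_in_q_edges[OF xy pq] supp_qvec_of[OF xy, of p q] pq xy by (auto simp: qvec_of_app)
    have "?z \<in> split_family n A L \<longleftrightarrow>
        (x \<in> A \<and> y \<in> A \<longrightarrow> (p, q) \<noteq> (2, 2)) \<and> (x \<notin> A \<and> y \<notin> A \<longrightarrow> (p, q) \<in> L)"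
    proof
      assume "?z \<in> split_family n A L"
      then have "(x \<in> A \<and> y \<in> A \<longrightarrow> (?z x, ?z y) \<noteq> (2, 2)) \<and> (x \<notin> A \<and> y \<notin> A \<longrightarrow> (?z x, ?z y) \<in> L)"
        using z(2) xy(3) unfolding split_family_def mem_Collect_eq by blast
      then show "(x \<in> A \<and> y \<in> A \<longrightarrow> (p, q) \<noteq> (2, 2)) \<and> (x \<notin> A \<and> y \<notin> A \<longrightarrow> (p, q) \<in> L)"
        unfolding z(3,4) .
    next
      assume R: "(x \<in> A \<and> y \<in> A \<longrightarrow> (p, q) \<noteq> (2, 2)) \<and> (x \<notin> A \<and> y \<notin> A \<longrightarrow> (p, q) \<in> L)"
      show "?z \<in> split_family n A L"
        unfolding split_family_def mem_Collect_eq z(2)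
      proof (intro conjI allI impI z(1))
        fix x' y' assume "{x, y} = {x', y'} \<and> x' \<noteq> y'"
        then consider "x' = x" "y' = y" | "x' = y" "y' = x" by (auto simp: doubleton_eq_iff)
        then show "x' \<in> A \<and> y' \<in> A \<Longrightarrow> (?z x', ?z y') \<noteq> (2, 2)"
          "x' \<notin> A \<and> y' \<notin> A \<Longrightarrow> (?z x', ?z y') \<in> L"
          using R z(3,4) sym[of p q] by (cases; auto)+
      qed
    qed
    then show ?thesis using pq xy(3) by (auto simp: labels_def)
  qed
  have R: "?R \<subseteq> {1, 2} \<times> {1, 2}" by auto
  show ?thesis
  proof (rule set_eqI)
    fix z :: "nat \<times> nat"
    obtain p q where z: "z = (p, q)" by fastforce
    show "z \<in> labels n (split_family n A L) x y \<longleftrightarrow> z \<in> ?R"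
    proof (cases "p \<in> {1, 2} \<and> q \<in> {1, 2}")
      case True
      then show ?thesis using iff z by simp
    next
      case False
      then have "z \<notin> {1, 2} \<times> {1, 2}" using z by auto
      then show ?thesis using R labels_subset[of n "split_family n A L" x y] by blast
    qed
  qed
qed

lemma sum_split_weights:
  fixes \<alpha> \<beta> \<gamma> :: nat
  assumes V: "finite V" "A \<subseteq> V"
  shows "(\<Sum>x\<in>V. \<Sum>y\<in>V. if x = y then 0 else if x \<in> A \<and> y \<in> A then \<alpha> else if x \<notin> A \<and> y \<notin> A then \<beta> else \<gamma>) =
    \<alpha> * (card A * (card A - 1)) + \<beta> * (card (V - A) * (card (V - A) - 1)) + 2 * \<gamma> * (card A * card (V - A))"
proof -
  let ?w = "\<lambda>x y. if x = y then 0 else if x \<in> A \<and> y \<in> A then \<alpha> else if x \<notin> A \<and> y \<notin> A then \<beta> else \<gamma>"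
  define B where "B = V - A"
  have V': "V = A \<union> B" "A \<inter> B = {}" "finite A" "finite B" using V finite_subset by (auto simp: B_def)
  have offdiag: "(\<Sum>y\<in>S. if x = y then 0 else c) = c * (card S - 1)" if "finite S" "x \<in> S" for S and x :: 'a and c :: nat
  proof -
    have "(\<Sum>y\<in>S. if x = y then 0 else c) = (\<Sum>y\<in>S - {x}. c)"
      using that by (intro sum.mono_neutral_cong_right) auto
    then show ?thesis using that by simp
  qed
  have "(\<Sum>y\<in>V. ?w x y) = \<alpha> * (card A - 1) + \<gamma> * card B" if "x \<in> A" for x
  proof -
    have "(\<Sum>y\<in>V. ?w x y) = (\<Sum>y\<in>A. ?w x y) + (\<Sum>y\<in>B. ?w x y)"
      using V' by (simp add: sum.union_disjoint)
    also have "(\<Sum>y\<in>A. ?w x y) = (\<Sum>y\<in>A. if x = y then 0 else \<alpha>)" using that by (intro sum.cong) auto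
    also have "(\<Sum>y\<in>B. ?w x y) = (\<Sum>y\<in>B. \<gamma>)" using that V' by (intro sum.cong) auto
    finally show ?thesis using offdiag[OF V'(3) that] by simp
  qed
  moreover have "(\<Sum>y\<in>V. ?w x y) = \<gamma> * card A + \<beta> * (card B - 1)" if "x \<in> B" for x
  proof -
    have "(\<Sum>y\<in>V. ?w x y) = (\<Sum>y\<in>A. ?w x y) + (\<Sum>y\<in>B. ?w x y)"
      using V' by (simp add: sum.union_disjoint)
    also have "(\<Sum>y\<in>A. ?w x y) = (\<Sum>y\<in>A. \<gamma>)" using that V' by (intro sum.cong) auto
    also have "(\<Sum>y\<in>B. ?w x y) = (\<Sum>y\<in>B. if x = y then 0 else \<beta>)" using that V' by (intro sum.cong) auto
    finally show ?thesis using offdiag[OF V'(4) that] by simp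
  qed
  moreover have "(\<Sum>x\<in>V. \<Sum>y\<in>V. ?w x y) = (\<Sum>x\<in>A. \<Sum>y\<in>V. ?w x y) + (\<Sum>x\<in>B. \<Sum>y\<in>V. ?w x y)"
  proof -
    have "(\<Sum>x\<in>A \<union> B. f x) = (\<Sum>x\<in>A. f x) + (\<Sum>x\<in>B. f x)" for f :: "'a \<Rightarrow> nat"
      by (rule sum.union_disjoint[OF V'(3,4,2)])
    then show ?thesis unfolding V'(1)[symmetric] by blast
  qed
  ultimately have "(\<Sum>x\<in>V. \<Sum>y\<in>V. ?w x y) =
      card A * (\<alpha> * (card A - 1) + \<gamma> * card B) + card B * (\<gamma> * card A + \<beta> * (card B - 1))"
    by simp
  then show ?thesis by (simp add: B_def distrib_left mult_ac)
qed

lemma card_split_family: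
  assumes A: "A \<subseteq> {1..n}" and sym: "\<And>p q. (p, q) \<in> L \<longleftrightarrow> (q, p) \<in> L"
  shows "2 * card (split_family n A L) = 3 * (card A * (card A - 1)) +
    card (L \<inter> ({1, 2} \<times> {1, 2})) * ((n - card A) * (n - card A - 1)) + 8 * (card A * (n - card A))"
proof -
  have three: "card ({1, 2} \<times> {1, 2} - {(2, 2)} :: (nat \<times> nat) set) = 3"
    by (simp add: card_Diff_singleton)
  have "2 * card (split_family n A L) = (\<Sum>x\<in>{1..n}. \<Sum>y\<in>{1..n}. card (labels n (split_family n A L) x y))"
    by (rule sum_card_labels[OF split_family_q_edges, symmetric])
  also have "\<dots> = (\<Sum>x\<in>{1..n}. \<Sum>y\<in>{1..n}. if x = y then 0 else if x \<in> A \<and> y \<in> A then 3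
      else if x \<notin> A \<and> y \<notin> A then card (L \<inter> ({1, 2} \<times> {1, 2})) else 4)"
  proof (intro sum.cong refl)
    fix x y assume xy: "x \<in> {1..n}" "y \<in> {1..n}"
    show "card (labels n (split_family n A L) x y) = (if x = y then 0 else if x \<in> A \<and> y \<in> A then 3
      else if x \<notin> A \<and> y \<notin> A then card (L \<inter> ({1, 2} \<times> {1, 2})) else 4)"
    proof (cases "x = y")
      case True
      then show ?thesis by (simp add: labels_def)
    next
      case False
      then show ?thesis unfolding labels_split_family[OF xy False sym] using three by simp
    qed
  qed
  also have "\<dots> = 3 * (card A * (card A - 1)) + card (L \<inter> ({1, 2} \<times> {1, 2})) *
      (card ({1..n} - A) * (card ({1..n} - A) - 1)) + 2 * 4 * (card A * card ({1..n} - A))"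
    by (rule sum_split_weights) (use A in auto)
  also have "card ({1..n} - A) = n - card A"
    using A by (simp add: card_Diff_subset finite_subset[OF A])
  finally show ?thesis by simp
qed

text \<open>If every edge within \<open>W\<close> has the entry \<open>1\<close> at one of its ends, then choosing such an end for each
edge is injective, because two edges with a common end cannot both have the entry \<open>1\<close> there. Hence
\<open>W\<close> spans at most as many edges as vertices.\<close>

lemma penalised_edges_le_vertices:
  fixes \<iota> :: "nat \<times> nat \<Rightarrow> nat" and X :: "(nat \<times> nat) set \<Rightarrow> qvec"
  assumes lab: "\<And>e e' v. \<lbrakk>e \<in> edges (complete_tripartite r s t); e' \<in> edges (complete_tripartite r s t);
      e \<noteq> e'; v \<in> e; v \<in> e'\<rbrakk> \<Longrightarrow> 3 \<le> X e (\<iota> v) + X e' (\<iota> v)"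
    and W: "W \<subseteq> tripartite_verts r s t"
    and pen: "\<And>u v. \<lbrakk>u \<in> W; v \<in> W; fst u < fst v\<rbrakk> \<Longrightarrow> X {u, v} (\<iota> u) = 1 \<or> X {u, v} (\<iota> v) = 1"
  defines "w k \<equiv> card {v \<in> W. fst v = k}"
  shows "w 0 * w 1 + w 0 * w 2 + w 1 * w 2 \<le> w 0 + w 1 + w 2"
proof -
  define P where "P k = {v \<in> W. fst v = k}" for k
  have "finite (tripartite_verts r s t)" by (simp add: tripartite_verts_def)
  then have finW: "finite W" using W finite_subset by blast
  then have fin: "finite (P k)" for k by (simp add: P_def)
  have w: "w k = card (P k)" for k by (simp add: w_def P_def)
  define D where "D = P 0 \<times> P 1 \<union> P 0 \<times> P 2 \<union> P 1 \<times> P 2"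
  define g where "g = (\<lambda>(u, v). if X {u, v} (\<iota> u) = 1 then u else v)"
  have D: "u \<in> W \<and> v \<in> W \<and> fst u < fst v" if "(u, v) \<in> D" for u v
    using that by (auto simp: D_def P_def)
  have cardD: "card D = w 0 * w 1 + w 0 * w 2 + w 1 * w 2"
  proof -
    have "card D = card (P 0 \<times> P 1 \<union> P 0 \<times> P 2) + card (P 1 \<times> P 2)"
      unfolding D_def using fin by (intro card_Un_disjoint) (auto simp: P_def)
    also have "card (P 0 \<times> P 1 \<union> P 0 \<times> P 2) = card (P 0 \<times> P 1) + card (P 0 \<times> P 2)"
      using fin by (intro card_Un_disjoint) (auto simp: P_def)
    finally show ?thesis by (simp add: card_cartesian_product w)
  qed
  have cardW: "card W = w 0 + w 1 + w 2"
  proof -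
    have "W = P 0 \<union> P 1 \<union> P 2" using W by (auto simp: P_def tripartite_verts_def)
    then have "card W = card (P 0 \<union> P 1 \<union> P 2)" by (rule arg_cong)
    also have "\<dots> = card (P 0 \<union> P 1) + card (P 2)"
      using fin by (intro card_Un_disjoint) (auto simp: P_def)
    also have "card (P 0 \<union> P 1) = card (P 0) + card (P 1)"
      using fin by (intro card_Un_disjoint) (auto simp: P_def)
    finally show ?thesis by (simp add: w)
  qed
  have edge: "{u, v} \<in> edges (complete_tripartite r s t)" if "(u, v) \<in> D" for u v
    using D[OF that] W by (auto simp: edges_complete_tripartite)
  have gW: "g (u, v) \<in> {u, v}" "X {u, v} (\<iota> (g (u, v))) = 1" if "(u, v) \<in> D" for u v
    using D[OF that] pen[of u v] by (auto simp: g_def)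
  have "inj_on g D"
  proof (rule inj_onI)
    fix a b assume a: "a \<in> D" and b: "b \<in> D" and eq: "g a = g b"
    obtain u v u' v' where uv: "a = (u, v)" "b = (u', v')" by (metis surj_pair)
    have "{u, v} = {u', v'}"
    proof (rule ccontr)
      assume "{u, v} \<noteq> {u', v'}"
      then have "3 \<le> X {u, v} (\<iota> (g a)) + X {u', v'} (\<iota> (g a))"
        using gW[of u v] gW[of u' v'] a b eq uv edge by (intro lab) auto
      then show False using gW(2)[of u v] gW(2)[of u' v'] a b eq uv by simp
    qed
    then show "a = b" using D[of u v] D[of u' v'] a b uv by (auto simp: doubleton_eq_iff)
  qed
  moreover have "g ` D \<subseteq> W" using gW(1) D by fastforce
  ultimately show ?thesis using card_inj_on_le[OF _ _ finW] cardD cardW by metis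
qed

text \<open>If all edges have only entries \<open>1\<close>, no two of them can meet in a copy.\<close>

lemma matching_in_neighbourhood:
  fixes \<iota> :: "nat \<times> nat \<Rightarrow> nat" and X :: "(nat \<times> nat) set \<Rightarrow> qvec"
  assumes lab: "\<And>e e' v. \<lbrakk>e \<in> edges (complete_tripartite r s t); e' \<in> edges (complete_tripartite r s t);
      e \<noteq> e'; v \<in> e; v \<in> e'\<rbrakk> \<Longrightarrow> 3 \<le> X e (\<iota> v) + X e' (\<iota> v)"
    and u: "u \<in> tripartite_verts r s t" and S: "S \<subseteq> tripartite_verts r s t"
    and pen: "\<And>v. v \<in> S \<Longrightarrow> fst v \<noteq> fst u \<and> X {u, v} (\<iota> u) = 1"
  shows "card S \<le> 1"
proof -
  have "v = v'" if "v \<in> S" "v' \<in> S" for v v'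
  proof (rule ccontr)
    assume "v \<noteq> v'"
    have "{u, v} \<in> edges (complete_tripartite r s t)" "{u, v'} \<in> edges (complete_tripartite r s t)"
      using that pen[of v] pen[of v'] u S by (intro edge_complete_tripartiteI; force)+
    moreover have "{u, v} \<noteq> {u, v'}" using \<open>v \<noteq> v'\<close> by (auto simp: doubleton_eq_iff)
    ultimately have "3 \<le> X {u, v} (\<iota> u) + X {u, v'} (\<iota> u)" by (intro lab) auto
    then show False using pen[OF that(1)] pen[OF that(2)] by simp
  qed
  moreover have "finite S" using S finite_subset by (fastforce simp: tripartite_verts_def)
  ultimately show ?thesis by (metis One_nat_def card_le_Suc0_iff_eq)
qed

text \<open>A copy in a split family distributes the \<open>N k\<close> first vertices of part \<open>k\<close> among \<open>A\<close> (\<open>a k\<close> of them) and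
its complement (\<open>b k\<close> of them). The numbers of edges that this leaves within \<open>A\<close> and within the
complement are bounded by the two preceding lemmas, so a copy is excluded by checking finitely many
distributions. Restricting to a bounded number of vertices in each part makes the check independent
of \<open>r\<close>, \<open>s\<close>, \<open>t\<close>.\<close>

lemma split_family_copy_sizes:
  assumes copy: "contains_copy n 3 (complete_tripartite r s t) (split_family n A L)"
    and N: "N 0 \<le> r" "N 1 \<le> s" "N 2 \<le> (t :: nat)"
  obtains a b :: "nat \<Rightarrow> nat" where
    "\<And>k. k \<in> {0, 1, 2} \<Longrightarrow> a k + b k = N k"
    "a 0 * a 1 + a 0 * a 2 + a 1 * a 2 \<le> a 0 + a 1 + a 2"
    "(2, 2) \<notin> L \<Longrightarrow> b 0 * b 1 + b 0 * b 2 + b 1 * b 2 \<le> b 0 + b 1 + b 2"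
    "L = {(1, 1)} \<Longrightarrow> (b 0 > 0 \<longrightarrow> b 1 + b 2 \<le> 1) \<and> (b 1 > 0 \<longrightarrow> b 0 + b 2 \<le> 1) \<and> (b 2 > 0 \<longrightarrow> b 0 + b 1 \<le> 1)"
    "{1..n} \<subseteq> A \<Longrightarrow> b 0 + b 1 + b 2 = 0"
proof -
  let ?F = "complete_tripartite r s t"
  obtain \<iota> X where inj: "inj_on \<iota> (verts ?F)" and img: "\<iota> ` verts ?F \<subseteq> {1..n}"
    and X: "\<And>e. e \<in> edges ?F \<Longrightarrow> X e \<in> split_family n A L \<and> supp n (X e) = \<iota> ` e"
    and lab: "\<And>e e' v. \<lbrakk>e \<in> edges ?F; e' \<in> edges ?F; e \<noteq> e'; v \<in> e; v \<in> e'\<rbrakk> \<Longrightarrow> 3 \<le> X e (\<iota> v) + X e' (\<iota> v)"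
    using contains_copyE[OF copy simple_graph_complete_tripartite split_family_q_edges] by blast
  define U where "U = Sigma {0, 1, 2} (\<lambda>k. {..<N k})"
  have U: "U \<subseteq> tripartite_verts r s t" using N by (auto simp: U_def tripartite_verts_def)
  have finU: "finite U" by (simp add: U_def)
  define WA where "WA = {v \<in> U. \<iota> v \<in> A}"
  define WB where "WB = {v \<in> U. \<iota> v \<notin> A}"
  define a where "a k = card {v \<in> WA. fst v = k}" for k
  define b where "b k = card {v \<in> WB. fst v = k}" for k
  have edge: "X {u, v} (\<iota> u) \<in> {1, 2}" "X {u, v} (\<iota> v) \<in> {1, 2}" "\<iota> u \<in> {1..n}" "\<iota> v \<in> {1..n}"
      "\<iota> u \<in> A \<Longrightarrow> \<iota> v \<in> A \<Longrightarrow> (X {u, v} (\<iota> u), X {u, v} (\<iota> v)) \<noteq> (2, 2)"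
      "\<iota> u \<notin> A \<Longrightarrow> \<iota> v \<notin> A \<Longrightarrow> (X {u, v} (\<iota> u), X {u, v} (\<iota> v)) \<in> L"
    if "u \<in> U" "v \<in> U" "fst u < fst v" for u v
  proof -
    have e: "{u, v} \<in> edges ?F" using that U by (auto simp: edges_complete_tripartite)
    have "\<iota> u \<noteq> \<iota> v" using inj that U by (auto simp: inj_on_def complete_tripartite_def)
    moreover have supp: "supp n (X {u, v}) = {\<iota> u, \<iota> v}" using X[OF e] by simp
    moreover have "X {u, v} \<in> q_edges 2 n" using X[OF e] split_family_q_edges by blast
    ultimately show "X {u, v} (\<iota> u) \<in> {1, 2}" "X {u, v} (\<iota> v) \<in> {1, 2}" "\<iota> u \<in> {1..n}" "\<iota> v \<in> {1..n}"
      using qvec_of_eq[of "X {u, v}" n "\<iota> u" "\<iota> v"] by blast+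
    have "X {u, v} \<in> split_family n A L" using X[OF e] by blast
    then show "\<iota> u \<in> A \<Longrightarrow> \<iota> v \<in> A \<Longrightarrow> (X {u, v} (\<iota> u), X {u, v} (\<iota> v)) \<noteq> (2, 2)"
      "\<iota> u \<notin> A \<Longrightarrow> \<iota> v \<notin> A \<Longrightarrow> (X {u, v} (\<iota> u), X {u, v} (\<iota> v)) \<in> L"
      using supp \<open>\<iota> u \<noteq> \<iota> v\<close> unfolding split_family_def by blast+
  qed
  show ?thesis
  proof (rule that[of a b])
    show "a k + b k = N k" if "k \<in> {0, 1, 2}" for k
    proof -
      have "a k + b k = card ({v \<in> WA. fst v = k} \<union> {v \<in> WB. fst v = k})"
        unfolding a_def b_def using finU by (intro card_Un_disjoint[symmetric]) (auto simp: WA_def WB_def)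
      also have "{v \<in> WA. fst v = k} \<union> {v \<in> WB. fst v = k} = {k} \<times> {..<N k}"
        using that by (auto simp: WA_def WB_def U_def)
      finally show ?thesis by (simp add: card_cartesian_product)
    qed
    show "a 0 * a 1 + a 0 * a 2 + a 1 * a 2 \<le> a 0 + a 1 + a 2"
      unfolding a_def
    proof (rule penalised_edges_le_vertices[where \<iota> = \<iota> and X = X, OF lab])
      show "WA \<subseteq> tripartite_verts r s t" using U by (auto simp: WA_def)
      fix u v assume "u \<in> WA" "v \<in> WA" "fst u < fst v"
      then show "X {u, v} (\<iota> u) = 1 \<or> X {u, v} (\<iota> v) = 1"
        using edge(1,2,5)[of u v] by (auto simp: WA_def)
    qed
    show "b 0 * b 1 + b 0 * b 2 + b 1 * b 2 \<le> b 0 + b 1 + b 2" if "(2, 2) \<notin> L"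
      unfolding b_def
    proof (rule penalised_edges_le_vertices[where \<iota> = \<iota> and X = X, OF lab])
      show "WB \<subseteq> tripartite_verts r s t" using U by (auto simp: WB_def)
      fix u v assume "u \<in> WB" "v \<in> WB" "fst u < fst v"
      then show "X {u, v} (\<iota> u) = 1 \<or> X {u, v} (\<iota> v) = 1"
        using edge(1,2,6)[of u v] that by (auto simp: WB_def)
    qed
    show "b 0 + b 1 + b 2 = 0" if "{1..n} \<subseteq> A"
    proof -
      have "\<iota> v \<in> A" if "v \<in> U" for v
      proof -
        have "v \<in> verts ?F" using that U by (auto simp: complete_tripartite_def)
        then show ?thesis using img \<open>{1..n} \<subseteq> A\<close> by blast
      qed
      then have "WB = {}" by (auto simp: WB_def)
      then show ?thesis by (simp add: b_def)
    qed
    show "(b 0 > 0 \<longrightarrow> b 1 + b 2 \<le> 1) \<and> (b 1 > 0 \<longrightarrow> b 0 + b 2 \<le> 1) \<and> (b 2 > 0 \<longrightarrow> b 0 + b 1 \<le> 1)"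
      if L: "L = {(1, 1)}"
    proof -
      have star: "b j + b k \<le> 1" if "b i > 0" "i \<noteq> j" "i \<noteq> k" "j \<noteq> k" for i j k
      proof -
        obtain u where u: "u \<in> WB" "fst u = i"
        proof -
          have "{v \<in> WB. fst v = i} \<noteq> {}" using \<open>b i > 0\<close> unfolding b_def by (metis card.empty less_irrefl)
          then show ?thesis using that by blast
        qed
        define S where "S = {v \<in> WB. fst v = j} \<union> {v \<in> WB. fst v = k}"
        have "X {u, v} (\<iota> u) = 1" if "v \<in> S" for v
        proof -
          have v: "v \<in> U" "u \<in> U" "\<iota> v \<notin> A" "\<iota> u \<notin> A" "fst u < fst v \<or> fst v < fst u"
            using that u \<open>i \<noteq> j\<close> \<open>i \<noteq> k\<close> by (auto simp: S_def WB_def)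
          then show ?thesis using edge(6)[of u v] edge(6)[of v u] L by (auto simp: insert_commute)
        qed
        then have "card S \<le> 1"
          using that U u by (intro matching_in_neighbourhood[where \<iota> = \<iota> and X = X and u = u, OF lab]) (auto simp: S_def WB_def)
        moreover have "card S = b j + b k"
          unfolding S_def b_def using finU that by (intro card_Un_disjoint) (auto simp: WB_def)
        ultimately show ?thesis by simp
      qed
      show ?thesis using star[of 0 1 2] star[of 1 0 2] star[of 2 0 1] by simp
    qed
  qed
qed

lemma ex_number_split_family_ge:
  assumes "1 \<le> r" "1 \<le> s" "\<not> contains_copy n 3 (complete_tripartite r s t) (split_family n A L)"
  shows "card (split_family n A L) \<le> ex_number n (complete_tripartite r s t) 2"
proof (rule card_le_ex_number)
  show "finite (edges (complete_tripartite r s t))" by (rule finite_edges[OF simple_graph_complete_tripartite])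
  show "edges (complete_tripartite r s t) \<noteq> {}" by (rule edges_complete_tripartite_nonempty[OF assms(1,2)])
  show "split_family n A L \<subseteq> q_edges 2 n" by (rule split_family_q_edges)
  show "\<not> contains_copy n (2 + 1) (complete_tripartite r s t) (split_family n A L)" using assms(3) by simp
qed

lemma no_split_2_3_3:
  fixes a0 a1 a2 b0 b1 b2 :: nat
  assumes "a0 + b0 = 2" "a1 + b1 = 3" "a2 + b2 = 3" "a0 * a1 + a0 * a2 + a1 * a2 \<le> a0 + a1 + a2"
    and "b0 > 0 \<longrightarrow> b1 + b2 \<le> 1" "b1 > 0 \<longrightarrow> b0 + b2 \<le> 1" "b2 > 0 \<longrightarrow> b0 + b1 \<le> 1"
  shows False
proof -
  have "a0 = 0 \<or> a0 = 1 \<or> a0 = 2" "a1 = 0 \<or> a1 = 1 \<or> a1 = 2 \<or> a1 = 3" using assms(1,2) by arith+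
  then show False using assms by (elim disjE; hypsubst; simp)
qed

lemma no_split_3_3_3:
  fixes a0 a1 a2 b0 b1 b2 :: nat
  assumes "a0 + b0 = 3" "a1 + b1 = 3" "a2 + b2 = 3" "a0 * a1 + a0 * a2 + a1 * a2 \<le> a0 + a1 + a2"
    and "b0 * b1 + b0 * b2 + b1 * b2 \<le> b0 + b1 + b2"
  shows False
proof -
  have b: "b0 = 3 - a0" "b1 = 3 - a1" "b2 = 3 - a2" using assms(1-3) by arith+
  have "a0 = 0 \<or> a0 = 1 \<or> a0 = 2 \<or> a0 = 3" "a1 = 0 \<or> a1 = 1 \<or> a1 = 2 \<or> a1 = 3"
    "a2 = 0 \<or> a2 = 1 \<or> a2 = 2 \<or> a2 = 3" using assms(1-3) by arith+
  then show False using assms(4,5) unfolding b by (elim disjE; hypsubst; simp)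
qed

text \<open>Here \<open>A\<close> is the whole vertex set, that is, all 2-edges but those of type \<open>(2, 2)\<close> are taken. The graph
\<open>K\<^sub>1\<^sub>,\<^sub>1\<^sub>,\<^sub>2\<close> has four vertices but five edges.\<close>

lemma ex_number_ge_3:
  assumes "1 \<le> r" "1 \<le> s" "2 \<le> t"
  shows "3 * (n * (n - 1)) \<le> 2 * ex_number n (complete_tripartite r s t) 2"
proof -
  let ?S = "split_family n {1..n} {(1, 1)}"
  have "\<not> contains_copy n 3 (complete_tripartite r s t) ?S"
  proof
    assume "contains_copy n 3 (complete_tripartite r s t) ?S"
    then show False
    proof (rule split_family_copy_sizes[where N = "\<lambda>k. if k = 2 then 2 else 1"])
      fix a b :: "nat \<Rightarrow> nat"
      assume ab: "\<And>k. k \<in> {0, 1, 2} \<Longrightarrow> a k + b k = (if k = 2 then 2 else 1)"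
        and a: "a 0 * a 1 + a 0 * a 2 + a 1 * a 2 \<le> a 0 + a 1 + a 2"
        and b: "{1..n} \<subseteq> {1..n} \<Longrightarrow> b 0 + b 1 + b 2 = 0"
      have "a 0 = 1" "a 1 = 1" "a 2 = 2" using ab[of 0] ab[of 1] ab[of 2] b by auto
      then show False using a by simp
    qed (use assms in auto)
  qed
  then have "card ?S \<le> ex_number n (complete_tripartite r s t) 2"
    using assms by (intro ex_number_split_family_ge)
  moreover have "2 * card ?S = 3 * (n * (n - 1))"
    by (subst card_split_family) auto
  ultimately show ?thesis by linarith
qed

text \<open>The density \<open>3 * x ^ 2 + (1 - x) ^ 2 + 8 * x * (1 - x)\<close> of the split family with \<open>card A = x * n\<close> and the
single type \<open>(1, 1)\<close> in the complement is maximal at \<open>x = 3 / 4\<close>, with value \<open>13 / 4\<close>. A copy of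
\<open>K\<^sub>2\<^sub>,\<^sub>3\<^sub>,\<^sub>3\<close> would have to leave a matching in the complement and at most as many edges as vertices
in \<open>A\<close>. The constant \<open>23\<close> is a generous bound for the rounding errors.\<close>

lemma ex_number_ge_13_4:
  assumes "2 \<le> r" "3 \<le> s" "3 \<le> t"
  shows "13 / 4 * (real n * (real n - 1)) - 23 * real n \<le> 2 * real (ex_number n (complete_tripartite r s t) 2)"
proof -
  define k where "k = n div 4"
  let ?S = "split_family n {1..3 * k} {(1, 1)}"
  have "\<not> contains_copy n 3 (complete_tripartite r s t) ?S"
  proof
    assume "contains_copy n 3 (complete_tripartite r s t) ?S"
    then show False
    proof (rule split_family_copy_sizes[where N = "\<lambda>k. if k = 0 then 2 else 3"])
      fix a b :: "nat \<Rightarrow> nat"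
      assume ab: "\<And>k. k \<in> {0, 1, 2} \<Longrightarrow> a k + b k = (if k = 0 then 2 else 3)"
        and a: "a 0 * a 1 + a 0 * a 2 + a 1 * a 2 \<le> a 0 + a 1 + a 2"
        and b: "{(1 :: nat, 1 :: nat)} = {(1, 1)} \<Longrightarrow> (b 0 > 0 \<longrightarrow> b 1 + b 2 \<le> 1) \<and> (b 1 > 0 \<longrightarrow> b 0 + b 2 \<le> 1) \<and> (b 2 > 0 \<longrightarrow> b 0 + b 1 \<le> 1)"
      show False using no_split_2_3_3[of "a 0" "b 0" "a 1" "b 1" "a 2" "b 2"] ab[of 0] ab[of 1] ab[of 2] a b
        by simp
    qed (use assms in auto)
  qed
  then have "card ?S \<le> ex_number n (complete_tripartite r s t) 2"
    using assms by (intro ex_number_split_family_ge) auto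
  moreover have "13 / 4 * (real n * (real n - 1)) - 23 * real n \<le> real (2 * card ?S)"
  proof -
    define d where "d = n mod 4"
    have n: "n = 4 * k + d" "d \<le> 3" by (auto simp: k_def d_def)
    have pred: "real (x * (x - 1)) = real x * real x - real x" for x by (cases x) (simp_all add: algebra_simps)
    define u where "u = 3 * k * (3 * k - 1)"
    define v where "v = (k + d) * (k + d - 1)"
    have uv: "real u = 3 * real k * (3 * real k) - 3 * real k"
      "real v = (real k + real d) * (real k + real d) - (real k + real d)"
      unfolding u_def v_def pred by simp_all
    have "2 * card ?S = 3 * u + v + 8 * (3 * k * (k + d))"
      unfolding u_def v_def using n by (subst card_split_family) auto
    then have "real (2 * card ?S) = real (3 * u + v + 8 * (3 * k * (k + d)))" by (rule arg_cong)
    also have "\<dots> = 3 * real u + real v + 24 * (real k * (real k + real d))" by simp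
    finally have "real (2 * card ?S) = 3 * real u + real v + 24 * (real k * (real k + real d))" .
    moreover have "real d * real d \<le> 3 * real d" using n(2) by (intro mult_right_mono) auto
    moreover have "real n = 4 * real k + real d" using n(1) by simp
    moreover from this have "13 / 4 * (real n * (real n - 1)) - 23 * real n = 52 * (real k * real k) +
        26 * (real k * real d) + 13 / 4 * (real d * real d) - 105 * real k - 105 / 4 * real d"
      by (simp add: algebra_simps)
    moreover have "3 * real u + real v + 24 * (real k * (real k + real d)) =
        52 * (real k * real k) + 26 * (real k * real d) + real d * real d - 10 * real k - real d"
      unfolding uv by (simp add: algebra_simps)
    ultimately show ?thesis by linarith
  qed
  ultimately show ?thesis by linarith
qed

text \<open>Two halves with all 2-edges across and every type but \<open>(2, 2)\<close> inside. Of the nine vertices of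
\<open>K\<^sub>3\<^sub>,\<^sub>3\<^sub>,\<^sub>3\<close>, at least five lie in the same half, and five vertices of it span at least six edges.\<close>

lemma ex_number_ge_7_2:
  assumes "3 \<le> r" "3 \<le> s" "3 \<le> t"
  shows "7 / 2 * (real n * (real n - 1)) - 23 * real n \<le> 2 * real (ex_number n (complete_tripartite r s t) 2)"
proof -
  define k where "k = n div 2"
  let ?S = "split_family n {1..k} (- {(2, 2)})"
  have "\<not> contains_copy n 3 (complete_tripartite r s t) ?S"
  proof
    assume "contains_copy n 3 (complete_tripartite r s t) ?S"
    then show False
    proof (rule split_family_copy_sizes[where N = "\<lambda>k. 3"])
      fix a b :: "nat \<Rightarrow> nat"
      assume ab: "\<And>k. k \<in> {0, 1, 2} \<Longrightarrow> a k + b k = 3"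
        and a: "a 0 * a 1 + a 0 * a 2 + a 1 * a 2 \<le> a 0 + a 1 + a 2"
        and b: "(2 :: nat, 2 :: nat) \<notin> - {(2, 2)} \<Longrightarrow> b 0 * b 1 + b 0 * b 2 + b 1 * b 2 \<le> b 0 + b 1 + b 2"
      show False using no_split_3_3_3[of "a 0" "b 0" "a 1" "b 1" "a 2" "b 2"] ab[of 0] ab[of 1] ab[of 2] a b
        by simp
    qed (use assms in auto)
  qed
  then have "card ?S \<le> ex_number n (complete_tripartite r s t) 2"
    using assms by (intro ex_number_split_family_ge) auto
  moreover have "7 / 2 * (real n * (real n - 1)) - 23 * real n \<le> real (2 * card ?S)"
  proof -
    define d where "d = n mod 2"
    have n: "n = 2 * k + d" "d \<le> 1" by (auto simp: k_def d_def)
    have pred: "real (x * (x - 1)) = real x * real x - real x" for x by (cases x) (simp_all add: algebra_simps)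
    have "- {(2, 2)} \<inter> {1, 2} \<times> {1, 2} = {(1, 1), (1, 2), (2 :: nat, 1 :: nat)}" by auto
    then have three: "card (- {(2, 2)} \<inter> {1, 2 :: nat} \<times> {1, 2 :: nat}) = 3" by simp
    define u where "u = k * (k - 1)"
    define v where "v = (k + d) * (k + d - 1)"
    have uv: "real u = real k * real k - real k"
      "real v = (real k + real d) * (real k + real d) - (real k + real d)"
      unfolding u_def v_def pred by simp_all
    have "2 * card ?S = 3 * u + 3 * v + 8 * (k * (k + d))"
      unfolding u_def v_def using n three by (subst card_split_family) auto
    then have "real (2 * card ?S) = real (3 * u + 3 * v + 8 * (k * (k + d)))" by (rule arg_cong)
    also have "\<dots> = 3 * real u + 3 * real v + 8 * (real k * (real k + real d))" by simp
    finally have "real (2 * card ?S) = 3 * real u + 3 * real v + 8 * (real k * (real k + real d))" .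
    moreover have "real d * real d \<le> 1 * real d" using n(2) by (intro mult_right_mono) auto
    moreover have "real n = 2 * real k + real d" using n(1) by simp
    moreover from this have "7 / 2 * (real n * (real n - 1)) - 23 * real n = 14 * (real k * real k) +
        14 * (real k * real d) + 7 / 2 * (real d * real d) - 53 * real k - 53 / 2 * real d"
      by (simp add: algebra_simps)
    moreover have "3 * real u + 3 * real v + 8 * (real k * (real k + real d)) =
        14 * (real k * real k) + 14 * (real k * real d) + 3 * (real d * real d) - 6 * real k - 3 * real d"
      unfolding uv by (simp add: algebra_simps)
    ultimately show ?thesis by linarith
  qed
  ultimately show ?thesis by linarith
qed

section \<open>Copies in blow-ups\<close>

text \<open>The embedding is given part by part, \<open>f k i\<close> being the image of vertex \<open>i\<close> of part \<open>k\<close>. Injectivity is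
needed within the parts only: vertices from different parts are joined by a nonempty type and hence
distinct.\<close>

lemma contains_tripartite_of_parts:
  fixes f :: "nat \<Rightarrow> nat \<Rightarrow> nat" and par :: "nat \<times> nat \<Rightarrow> nat \<times> nat"
  assumes pos: "1 \<le> r" "1 \<le> s" "1 \<le> t"
    and inj: "inj_on (f 0) {..<r}" "inj_on (f 1) {..<s}" "inj_on (f 2) {..<t}"
    and img: "f 0 ` {..<r} \<subseteq> {1..n}" "f 1 ` {..<s} \<subseteq> {1..n}" "f 2 ` {..<t} \<subseteq> {1..n}"
    and lab01: "\<And>i j. \<lbrakk>i < r; j < s\<rbrakk> \<Longrightarrow> \<exists>(p, q) \<in> labels n H (f 0 i) (f 1 j).
      (p = 2 \<or> par (0, i) = (1, j)) \<and> (q = 2 \<or> par (1, j) = (0, i))"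
    and lab02: "\<And>i j. \<lbrakk>i < r; j < t\<rbrakk> \<Longrightarrow> \<exists>(p, q) \<in> labels n H (f 0 i) (f 2 j).
      (p = 2 \<or> par (0, i) = (2, j)) \<and> (q = 2 \<or> par (2, j) = (0, i))"
    and lab12: "\<And>i j. \<lbrakk>i < s; j < t\<rbrakk> \<Longrightarrow> \<exists>(p, q) \<in> labels n H (f 1 i) (f 2 j).
      (p = 2 \<or> par (1, i) = (2, j)) \<and> (q = 2 \<or> par (2, j) = (1, i))"
  shows "contains_copy n 3 (complete_tripartite r s t) H"
proof (rule contains_tripartiteI[OF pos])
  let ?\<iota> = "\<lambda>(k, i). f k i"
  show lab: "\<exists>(p, q) \<in> labels n H (?\<iota> u) (?\<iota> v). (p = 2 \<or> par u = v) \<and> (q = 2 \<or> par v = u)"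
    if u_v: "u \<in> tripartite_verts r s t" "v \<in> tripartite_verts r s t" "fst u < fst v" for u v
  proof -
    obtain k i l j where uv: "u = (k, i)" "v = (l, j)" by (metis surj_pair)
    consider "k = 0" "l = 1" "i < r" "j < s" | "k = 0" "l = 2" "i < r" "j < t" | "k = 1" "l = 2" "i < s" "j < t"
      using u_v uv by (auto simp: tripartite_verts_def)
    then show ?thesis
    proof cases
      case 1
      then show ?thesis using lab01[of i j] uv by simp
    next
      case 2
      then show ?thesis using lab02[of i j] uv by simp
    next
      case 3
      then show ?thesis using lab12[of i j] uv by simp
    qed
  qed
  have diff: "?\<iota> u \<noteq> ?\<iota> v" if "u \<in> tripartite_verts r s t" "v \<in> tripartite_verts r s t" "fst u < fst v" for u v
  proof
    assume "?\<iota> u = ?\<iota> v"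
    then have "labels n H (?\<iota> u) (?\<iota> v) = {}" by (simp add: labels_def)
    then show False using lab[OF that] by simp
  qed
  show "inj_on ?\<iota> (tripartite_verts r s t)"
  proof (rule inj_onI)
    fix u v assume uv: "u \<in> tripartite_verts r s t" "v \<in> tripartite_verts r s t" "?\<iota> u = ?\<iota> v"
    then have "fst u = fst v" using diff[of u v] diff[of v u] by (metis linorder_neq_iff)
    then show "u = v" using uv inj by (auto simp: tripartite_verts_def inj_on_def)
  qed
  show "?\<iota> ` tripartite_verts r s t \<subseteq> {1..n}" using img by (auto simp: tripartite_verts_def)
qed

text \<open>All edges between the two sets can be chosen without an entry \<open>1\<close>. This is what a pair of weight \<open>4\<close> in
a pattern becomes in its blow-up.\<close>

definition full_pair :: "nat \<Rightarrow> qvec set \<Rightarrow> nat set \<Rightarrow> nat set \<Rightarrow> bool" where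
  "full_pair n H A B \<longleftrightarrow> (\<forall>x\<in>A. \<forall>y\<in>B. (2, 2) \<in> labels n H x y)"

text \<open>All edges between the two sets can be chosen so that entries \<open>1\<close> occur in \<open>B\<close> only. In the blow-up, a
pair of weight at least \<open>3\<close> has this property in both directions, and a pair of weight \<open>2\<close> in at least
one direction.\<close>

definition free_at_left :: "nat \<Rightarrow> qvec set \<Rightarrow> nat set \<Rightarrow> nat set \<Rightarrow> bool" where
  "free_at_left n H A B \<longleftrightarrow> (\<forall>x\<in>A. \<forall>y\<in>B. \<exists>q. (2, q) \<in> labels n H x y)"

lemma full_pair_swap: "full_pair n H A B \<Longrightarrow> full_pair n H B A"
  unfolding full_pair_def by (intro ballI, subst mem_labels_swap) blast

lemma obtain_enumeration:
  fixes A :: "nat set"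
  assumes "A \<subseteq> {1..n}" "k \<le> card A"
  obtains f where "inj_on f {..<k}" "f ` {..<k} \<subseteq> A"
proof -
  obtain A' where A': "A' \<subseteq> A" "card A' = k" "finite A'"
    using obtain_subset_with_card_n[OF assms(2)] by metis
  then obtain h where "bij_betw h {0..<k} A'" using ex_bij_betw_nat_finite by blast
  then show ?thesis using that[of h] A'(1) by (auto simp: bij_betw_def lessThan_atLeast0)
qed

lemma contains_tripartite_full_triangle:
  assumes "1 \<le> r" "1 \<le> s" "1 \<le> t" and sub: "A \<subseteq> {1..n}" "B \<subseteq> {1..n}" "C \<subseteq> {1..n}"
    and card: "r \<le> card A" "s \<le> card B" "t \<le> card C"
    and full: "full_pair n H A B" "full_pair n H A C" "full_pair n H B C"
  shows "contains_copy n 3 (complete_tripartite r s t) H"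
proof -
  obtain a where a: "inj_on a {..<r}" "a ` {..<r} \<subseteq> A" using obtain_enumeration sub card by metis
  obtain b where b: "inj_on b {..<s}" "b ` {..<s} \<subseteq> B" using obtain_enumeration sub card by metis
  obtain c where c: "inj_on c {..<t}" "c ` {..<t} \<subseteq> C" using obtain_enumeration sub card by metis
  have mem: "i < r \<Longrightarrow> a i \<in> A" "i < s \<Longrightarrow> b i \<in> B" "i < t \<Longrightarrow> c i \<in> C" for i using a b c by auto
  have lab: "\<lbrakk>i < r; j < s\<rbrakk> \<Longrightarrow> (2, 2) \<in> labels n H (a i) (b j)"
    "\<lbrakk>i < r; j < t\<rbrakk> \<Longrightarrow> (2, 2) \<in> labels n H (a i) (c j)"
    "\<lbrakk>i < s; j < t\<rbrakk> \<Longrightarrow> (2, 2) \<in> labels n H (b i) (c j)" for i j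
    using full mem unfolding full_pair_def by blast+
  show ?thesis
    by (rule contains_tripartite_of_parts[where f = "\<lambda>k. if k = 0 then a else if k = 1 then b else c" and par = id])
      (use assms(1-3) a b c sub lab in \<open>auto intro!: bexI[of _ "(2, 2)"]\<close>)
qed

text \<open>One vertex of the part of size 2 is placed in \<open>A\<close>, the other in \<open>C\<close>, and the other parts in \<open>B\<close> and \<open>D\<close>.
The edges that are not on the full 4-cycle form a star from \<open>A\<close> to \<open>D\<close> and a star from \<open>C\<close> to \<open>B\<close>, and
both can be chosen with entries \<open>1\<close> at the leaves only.\<close>

lemma contains_tripartite_full_cycle:
  assumes "1 \<le> s" "1 \<le> t" and sub: "A \<subseteq> {1..n}" "B \<subseteq> {1..n}" "C \<subseteq> {1..n}" "D \<subseteq> {1..n}"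
    and card: "1 \<le> card A" "1 \<le> card C" "t \<le> card B" "s \<le> card D"
    and full: "full_pair n H A B" "full_pair n H B D" "full_pair n H D C" "full_pair n H C A"
    and free: "free_at_left n H A D" "free_at_left n H C B"
  shows "contains_copy n 3 (complete_tripartite 2 s t) H"
proof -
  obtain a where a: "a \<in> A" using card by fastforce
  obtain c where c: "c \<in> C" using card by fastforce
  obtain b where b: "inj_on b {..<t}" "b ` {..<t} \<subseteq> B" using obtain_enumeration sub card by metis
  obtain d where d: "inj_on d {..<s}" "d ` {..<s} \<subseteq> D" using obtain_enumeration sub card by metis
  have mem: "i < t \<Longrightarrow> b i \<in> B" "i < s \<Longrightarrow> d i \<in> D" for i using b d by auto
  have lab: "i < t \<Longrightarrow> (2, 2) \<in> labels n H a (b i)" "i < s \<Longrightarrow> (2, 2) \<in> labels n H c (d i)"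
    "i < s \<Longrightarrow> j < t \<Longrightarrow> (2, 2) \<in> labels n H (d i) (b j)"
    "i < s \<Longrightarrow> \<exists>q. (2, q) \<in> labels n H a (d i)" "i < t \<Longrightarrow> \<exists>q. (2, q) \<in> labels n H c (b i)" for i j
    using full(1) full_pair_swap[OF full(2)] full_pair_swap[OF full(3)] free mem a c
    unfolding full_pair_def free_at_left_def by blast+
  have "(2, 2) \<in> labels n H c a" using full(4) a c unfolding full_pair_def by blast
  then have "a \<noteq> c" by (auto simp: labels_def)
  define f where "f k = (if k = 0 then (\<lambda>i. if i = 0 then a else c) else if k = 1 then d else b)" for k :: nat
  define par :: "nat \<times> nat \<Rightarrow> nat \<times> nat" where "par v = (if fst v = 1 then (0, 0) else (0, 1))" for v
  show ?thesis
  proof (rule contains_tripartite_of_parts[where f = f and par = par])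
    show "inj_on (f 0) {..<2 :: nat}" using \<open>a \<noteq> c\<close> by (auto simp: f_def inj_on_def)
    show "f 0 ` {..<2 :: nat} \<subseteq> {1..n}" using a c sub by (auto simp: f_def)
    show "\<exists>(p, q)\<in>labels n H (f 0 i) (f 1 j). (p = 2 \<or> par (0, i) = (1, j)) \<and> (q = 2 \<or> par (1, j) = (0, i))"
      if ij: "i < 2" "j < s" for i j
    proof (cases "i = 0")
      case True
      obtain q where "(2, q) \<in> labels n H a (d j)" using lab(4)[OF ij(2)] by blast
      then show ?thesis using True by (intro bexI[of _ "(2, q)"]) (auto simp: f_def par_def)
    next
      case False
      then show ?thesis using lab(2)[OF ij(2)] by (intro bexI[of _ "(2, 2)"]) (auto simp: f_def)
    qed
    show "\<exists>(p, q)\<in>labels n H (f 0 i) (f 2 j). (p = 2 \<or> par (0, i) = (2, j)) \<and> (q = 2 \<or> par (2, j) = (0, i))"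
      if ij: "i < 2" "j < t" for i j
    proof (cases "i = 0")
      case False
      then have "i = 1" using ij by simp
      obtain q where "(2, q) \<in> labels n H c (b j)" using lab(5)[OF ij(2)] by blast
      then show ?thesis using \<open>i = 1\<close> by (intro bexI[of _ "(2, q)"]) (auto simp: f_def par_def)
    next
      case True
      then show ?thesis using lab(1)[OF ij(2)] by (intro bexI[of _ "(2, 2)"]) (auto simp: f_def)
    qed
    show "\<exists>(p, q)\<in>labels n H (f 1 i) (f 2 j). (p = 2 \<or> par (1, i) = (2, j)) \<and> (q = 2 \<or> par (2, j) = (1, i))"
      if ij: "i < s" "j < t" for i j
      using lab(3)[OF ij] by (intro bexI[of _ "(2, 2)"]) (auto simp: f_def)
    show "f 1 ` {..<s} \<subseteq> {1..n}" "f 2 ` {..<t} \<subseteq> {1..n}" using b d sub by (auto simp: f_def)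
    show "inj_on (f 1) {..<s}" "inj_on (f 2) {..<t}" using b d by (auto simp: f_def)
  qed (use assms(1,2) in simp_all)
qed

text \<open>The parts of sizes \<open>t\<close> and \<open>s\<close> are placed in \<open>A\<close> and \<open>B\<close>; the single vertex in \<open>C\<close> is the centre of a star
that has entries \<open>1\<close> only at its leaves in \<open>B\<close>.\<close>

lemma contains_tripartite_1_star:
  assumes "1 \<le> s" "1 \<le> t" and sub: "A \<subseteq> {1..n}" "B \<subseteq> {1..n}" "C \<subseteq> {1..n}"
    and card: "t \<le> card A" "s \<le> card B" "1 \<le> card C"
    and full: "full_pair n H A B" "full_pair n H A C" and free: "free_at_left n H C B"
  shows "contains_copy n 3 (complete_tripartite 1 s t) H"
proof -
  obtain c where c: "c \<in> C" using card by fastforce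
  obtain a where a: "inj_on a {..<t}" "a ` {..<t} \<subseteq> A" using obtain_enumeration sub card by metis
  obtain b where b: "inj_on b {..<s}" "b ` {..<s} \<subseteq> B" using obtain_enumeration sub card by metis
  have mem: "i < t \<Longrightarrow> a i \<in> A" "i < s \<Longrightarrow> b i \<in> B" for i using a b by auto
  have lab: "i < t \<Longrightarrow> (2, 2) \<in> labels n H c (a i)"
    "i < s \<Longrightarrow> j < t \<Longrightarrow> (2, 2) \<in> labels n H (b i) (a j)"
    "i < s \<Longrightarrow> \<exists>q. (2, q) \<in> labels n H c (b i)" for i j
    using full_pair_swap[OF full(1)] full_pair_swap[OF full(2)] free mem c
    unfolding full_pair_def free_at_left_def by blast+
  define f where "f k = (if k = 0 then (\<lambda>_. c) else if k = 1 then b else a)" for k :: nat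
  define par :: "nat \<times> nat \<Rightarrow> nat \<times> nat" where "par v = (0, 0)" for v
  show ?thesis
  proof (rule contains_tripartite_of_parts[where f = f and par = par])
    show "\<exists>(p, q)\<in>labels n H (f 0 i) (f 1 j). (p = 2 \<or> par (0, i) = (1, j)) \<and> (q = 2 \<or> par (1, j) = (0, i))"
      if ij: "i < 1" "j < s" for i j
    proof -
      obtain q where "(2, q) \<in> labels n H c (b j)" using lab(3)[OF ij(2)] by blast
      then show ?thesis using \<open>i < 1\<close> by (intro bexI[of _ "(2, q)"]) (auto simp: f_def par_def)
    qed
    show "\<exists>(p, q)\<in>labels n H (f 0 i) (f 2 j). (p = 2 \<or> par (0, i) = (2, j)) \<and> (q = 2 \<or> par (2, j) = (0, i))"
      if ij: "i < 1" "j < t" for i j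
      using lab(1)[OF ij(2)] by (intro bexI[of _ "(2, 2)"]) (auto simp: f_def)
    show "\<exists>(p, q)\<in>labels n H (f 1 i) (f 2 j). (p = 2 \<or> par (1, i) = (2, j)) \<and> (q = 2 \<or> par (2, j) = (1, i))"
      if ij: "i < s" "j < t" for i j
      using lab(2)[OF ij] by (intro bexI[of _ "(2, 2)"]) (auto simp: f_def)
    show "f 0 ` {..<1 :: nat} \<subseteq> {1..n}" using c sub by (auto simp: f_def)
    show "f 1 ` {..<s} \<subseteq> {1..n}" "f 2 ` {..<t} \<subseteq> {1..n}" using a b sub by (auto simp: f_def)
    show "inj_on (f 1) {..<s}" "inj_on (f 2) {..<t}" using a b by (auto simp: f_def)
    show "inj_on (f 0) {..<1 :: nat}" by (auto simp: f_def inj_on_def)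
  qed (use assms(1,2) in simp_all)
qed

text \<open>The part of size \<open>t\<close> is placed in \<open>A\<close>. The parts in \<open>B\<close> and \<open>C\<close> span a 4-cycle, which is oriented
cyclically so that each of its vertices has the entry \<open>1\<close> on one edge only.\<close>

lemma contains_tripartite_2_2:
  assumes "1 \<le> t" and sub: "A \<subseteq> {1..n}" "B \<subseteq> {1..n}" "C \<subseteq> {1..n}"
    and card: "t \<le> card A" "2 \<le> card B" "2 \<le> card C"
    and full: "full_pair n H A B" "full_pair n H A C"
    and free: "free_at_left n H B C" "free_at_left n H C B"
  shows "contains_copy n 3 (complete_tripartite 2 2 t) H"
proof -
  obtain a where a: "inj_on a {..<t}" "a ` {..<t} \<subseteq> A" using obtain_enumeration sub card by metis
  obtain b where b: "inj_on b {..<2 :: nat}" "b ` {..<2 :: nat} \<subseteq> B" using obtain_enumeration sub card by metis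
  obtain c where c: "inj_on c {..<2 :: nat}" "c ` {..<2 :: nat} \<subseteq> C" using obtain_enumeration sub card by metis
  have mem: "i < t \<Longrightarrow> a i \<in> A" "j < 2 \<Longrightarrow> b j \<in> B" "j < 2 \<Longrightarrow> c j \<in> C" for i j using a b c by auto
  have lab: "i < 2 \<Longrightarrow> j < t \<Longrightarrow> (2, 2) \<in> labels n H (b i) (a j)"
    "i < 2 \<Longrightarrow> j < t \<Longrightarrow> (2, 2) \<in> labels n H (c i) (a j)" for i j
    using full_pair_swap[OF full(1)] full_pair_swap[OF full(2)] mem unfolding full_pair_def by blast+
  have left: "\<exists>q. (2, q) \<in> labels n H (b i) (c j)" if ij: "i < 2" "j < 2" for i j
    using free(1) mem ij unfolding free_at_left_def by blast
  have right: "\<exists>p. (p, 2) \<in> labels n H (b i) (c j)" if ij: "i < 2" "j < 2" for i j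
  proof -
    have "\<exists>p. (2, p) \<in> labels n H (c j) (b i)" using free(2) mem ij unfolding free_at_left_def by blast
    then show ?thesis using mem_labels_swap[of _ 2 n H "b i" "c j"] by blast
  qed
  define f where "f k = (if k = 0 then b else if k = 1 then c else a)" for k :: nat
  \<comment> \<open>The value \<open>par v\<close> is the predecessor of \<open>v\<close> on the cycle (0,
    0), (1, 0), (0, 1), (1, 1).\<close>
  define par :: "nat \<times> nat \<Rightarrow> nat \<times> nat" where
    "par v = (if v = (1, 0) then (0, 0) else if v = (0, 1) then (1, 0) else if v = (1, 1) then (0, 1) else (1, 1))" for v
  show ?thesis
  proof (rule contains_tripartite_of_parts[where f = f and par = par])
    show "\<exists>(p, q)\<in>labels n H (f 0 i) (f 1 j). (p = 2 \<or> par (0, i) = (1, j)) \<and> (q = 2 \<or> par (1, j) = (0, i))"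
      if ij: "i < 2" "j < 2" for i j
    proof (cases "i = j")
      case True
      obtain q where "(2, q) \<in> labels n H (b i) (c j)" using left[OF ij] by blast
      then show ?thesis using True ij by (intro bexI[of _ "(2, q)"]) (auto simp: f_def par_def)
    next
      case False
      obtain p where "(p, 2) \<in> labels n H (b i) (c j)" using right[OF ij] by blast
      then show ?thesis using False ij by (intro bexI[of _ "(p, 2)"]) (auto simp: f_def par_def)
    qed
    show "\<exists>(p, q)\<in>labels n H (f 0 i) (f 2 j). (p = 2 \<or> par (0, i) = (2, j)) \<and> (q = 2 \<or> par (2, j) = (0, i))"
      if ij: "i < 2" "j < t" for i j
      using lab(1)[OF ij] by (intro bexI[of _ "(2, 2)"]) (auto simp: f_def)
    show "\<exists>(p, q)\<in>labels n H (f 1 i) (f 2 j). (p = 2 \<or> par (1, i) = (2, j)) \<and> (q = 2 \<or> par (2, j) = (1, i))"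
      if ij: "i < 2" "j < t" for i j
      using lab(2)[OF ij] by (intro bexI[of _ "(2, 2)"]) (auto simp: f_def)
    show "f 0 ` {..<2 :: nat} \<subseteq> {1..n}" "f 1 ` {..<2 :: nat} \<subseteq> {1..n}" "f 2 ` {..<t} \<subseteq> {1..n}"
      using a b c sub by (auto simp: f_def)
    show "inj_on (f 0) {..<2 :: nat}" "inj_on (f 1) {..<2 :: nat}" "inj_on (f 2) {..<t}" using a b c by (auto simp: f_def)
  qed (use assms(1) in simp_all)
qed

section \<open>Upper bounds\<close>

lemma label_set_cases:
  fixes S :: "(nat \<times> nat) set"
  assumes "S \<subseteq> {1, 2} \<times> {1, 2}"
  shows "card S \<le> 4" "card S = 4 \<Longrightarrow> (2, 2) \<in> S" "3 \<le> card S \<Longrightarrow> \<exists>q. (2, q) \<in> S"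
    "2 \<le> card S \<Longrightarrow> (\<exists>q. (2, q) \<in> S) \<or> (\<exists>p. (p, 2) \<in> S)"
proof -
  have fin: "finite S" using assms finite_subset by blast
  have four: "card ({1, 2} \<times> {1, 2} :: (nat \<times> nat) set) = 4" by simp
  show "card S \<le> 4" using card_mono[OF _ assms] four by simp
  show "(2, 2) \<in> S" if "card S = 4"
    using card_subset_eq[OF _ assms] four that by auto
  show "\<exists>q. (2, q) \<in> S" if "3 \<le> card S"
  proof (rule ccontr)
    assume "\<not> ?thesis"
    then have "S \<subseteq> {(1, 1), (1, 2)}" using assms by auto
    then have "card S \<le> card {(1, 1), (1 :: nat, 2 :: nat)}" by (intro card_mono) auto
    then show False using that by simp
  qed
  show "(\<exists>q. (2, q) \<in> S) \<or> (\<exists>p. (p, 2) \<in> S)" if "2 \<le> card S"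
  proof (rule ccontr)
    assume "\<not> ?thesis"
    then have "S \<subseteq> {(1, 1)}" using assms by auto
    then have "card S \<le> card {(1 :: nat, 1 :: nat)}" by (intro card_mono) auto
    then show False using that by simp
  qed
qed

text \<open>To bound the extremal number by density \<open>c\<close> asymptotically, it suffices to find a copy in the blow-up
of every weighted pattern of total weight more than \<open>c * m ^ 2 + K * m\<close>: the types of an extremal
family form the colouring \<open>\<tau>\<close> in \<open>blow_up_of_dense_pattern\<close>, weighted by their cardinality. Of the blown-up
types, only the weights and the properties \<open>full_pair\<close> and \<open>free_at_left\<close> are retained.\<close>

lemma ex_number_le_of_pattern:
  fixes c K :: real and F :: "'a graph" and \<tau> :: nat
  assumes F: "finite (edges F)" "edges F \<noteq> {}" and c: "0 \<le> c" "0 \<le> K" and \<tau>: "1 \<le> \<tau>"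
    and pattern: "\<And>n H m T w. \<lbrakk>\<And>a. a < m \<Longrightarrow> T a \<subseteq> {1..n} \<and> card (T a) = \<tau>;
      \<And>a b. w a b = w b a; \<And>a. w a a = (0 :: nat); \<And>a b. w a b \<le> 4;
      \<And>a b. w a b = 4 \<Longrightarrow> full_pair n H (T a) (T b);
      \<And>a b. 3 \<le> w a b \<Longrightarrow> free_at_left n H (T a) (T b);
      \<And>a b. 2 \<le> w a b \<Longrightarrow> free_at_left n H (T a) (T b) \<or> free_at_left n H (T b) (T a);
      c * real m ^ 2 + K * real m < real (\<Sum>a<m. \<Sum>b<m. w a b)\<rbrakk> \<Longrightarrow> contains_copy n 3 F H"
    and "0 < \<epsilon>"
  shows "\<exists>N. \<forall>n\<ge>N. 2 * real (ex_number n F 2) < (c + \<epsilon>) * real n ^ 2"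
proof -
  let ?C = "Pow ({1, 2} \<times> {1, 2}) :: (nat \<times> nat) set set"
  have finC: "finite ?C" by simp
  have card4: "\<forall>S\<in>?C. card S \<le> 4" using label_set_cases(1) by blast
  obtain m N where blow: "\<forall>(V :: nat set) \<tau>'. finite V \<longrightarrow> N \<le> card V \<longrightarrow> (\<forall>x\<in>V. \<forall>y\<in>V. \<tau>' x y \<in> ?C) \<longrightarrow>
    (c + \<epsilon>) * real (card V) ^ 2 \<le> real (\<Sum>x\<in>V. \<Sum>y\<in>V. card (\<tau>' x y)) \<longrightarrow>
    (\<exists>T P. (\<forall>a<m. T a \<subseteq> V \<and> card (T a) = \<tau>) \<and>
      (\<forall>a<m. \<forall>b<m. a \<noteq> b \<longrightarrow> (\<forall>x\<in>T a. \<forall>y\<in>T b. \<tau>' x y = P a b)) \<and>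
      (\<forall>a<m. \<forall>b<m. P a b \<in> ?C) \<and>
      c * real m ^ 2 + K * real m < real (\<Sum>a<m. \<Sum>b<m. if a = b then 0 else card (P a b)))"
    using blow_up_of_dense_pattern[where C = ?C and wt = card and t = \<tau>, OF finC \<open>0 < \<epsilon>\<close> c card4]
    by (elim exE) (rule that)
  have "2 * real (ex_number n F 2) < (c + \<epsilon>) * real n ^ 2" if "N \<le> n" for n
  proof (rule ccontr)
    assume dense: "\<not> 2 * real (ex_number n F 2) < (c + \<epsilon>) * real n ^ 2"
    obtain H where H: "H \<subseteq> q_edges 2 n" "\<not> contains_copy n (2 + 1) F H" "card H = ex_number n F 2"
      using ex_number_attained[OF F] by blast
    have "real (\<Sum>x\<in>{1..n}. \<Sum>y\<in>{1..n}. card (labels n H x y)) = 2 * real (ex_number n F 2)"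
      unfolding sum_card_labels[OF H(1)] using H(3) by simp
    then have "(c + \<epsilon>) * real (card {1..n}) ^ 2 \<le> real (\<Sum>x\<in>{1..n}. \<Sum>y\<in>{1..n}. card (labels n H x y))"
      using dense by simp
    moreover have "\<forall>x\<in>{1..n}. \<forall>y\<in>{1..n}. labels n H x y \<in> ?C" using labels_subset by blast
    ultimately have "\<exists>T P. (\<forall>a<m. T a \<subseteq> {1..n} \<and> card (T a) = \<tau>) \<and>
      (\<forall>a<m. \<forall>b<m. a \<noteq> b \<longrightarrow> (\<forall>x\<in>T a. \<forall>y\<in>T b. labels n H x y = P a b)) \<and>
      (\<forall>a<m. \<forall>b<m. P a b \<in> ?C) \<and>
      c * real m ^ 2 + K * real m < real (\<Sum>a<m. \<Sum>b<m. if a = b then 0 else card (P a b))"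
      using blow[rule_format, of "{1..n}" "labels n H"] that by simp
    then obtain T P where T: "\<forall>a<m. T a \<subseteq> {1..n} \<and> card (T a) = \<tau>"
      and P: "\<forall>a<m. \<forall>b<m. a \<noteq> b \<longrightarrow> (\<forall>x\<in>T a. \<forall>y\<in>T b. labels n H x y = P a b)"
      and PC: "\<forall>a<m. \<forall>b<m. P a b \<in> ?C"
      and large: "c * real m ^ 2 + K * real m < real (\<Sum>a<m. \<Sum>b<m. if a = b then 0 else card (P a b))"
      by (elim exE conjE) (rule that)
    note T = T[rule_format] and P = P[rule_format]
    have PC: "P a b \<subseteq> {1, 2} \<times> {1, 2}" if "a < m" "b < m" for a b using PC that by blast
    \<comment> \<open>The weights vanish beyond the indices of the pattern, so that symmetry and the bound
      \<open>4\<close> hold everywhere.\<close>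
    define w where "w a b = (if a < m \<and> b < m \<and> a \<noteq> b then card (P a b) else 0)" for a b
    have w: "a < m \<and> b < m \<and> a \<noteq> b \<and> w a b = card (P a b)" if "0 < w a b" for a b
      using that by (auto simp: w_def split: if_splits)
    have ex_T: "\<exists>x. x \<in> T a" if "a < m" for a
    proof -
      have "T a \<noteq> {}" using T[OF that] \<tau> by auto
      then show ?thesis by blast
    qed
    have P_swap: "(p, q) \<in> P a b \<longleftrightarrow> (q, p) \<in> P b a" if ab: "a < m" "b < m" "a \<noteq> b" for a b p q
    proof -
      obtain x y where "x \<in> T a" "y \<in> T b" using ex_T ab by metis
      then have "labels n H x y = P a b" "labels n H y x = P b a" using P ab by auto
      then show ?thesis using mem_labels_swap[of p q n H x y] by metis
    qed
    have "contains_copy n 3 F H"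
    proof (rule pattern[of m T n w H])
      show "T a \<subseteq> {1..n} \<and> card (T a) = \<tau>" if "a < m" for a using T[OF that] .
      show "w a a = 0" for a by (simp add: w_def)
      show "w a b \<le> 4" for a b using PC label_set_cases(1) by (simp add: w_def)
      show "w a b = w b a" for a b
      proof (cases "a < m \<and> b < m \<and> a \<noteq> b")
        case True
        have "z \<in> P b a \<longleftrightarrow> z \<in> prod.swap ` P a b" for z
        proof -
          have "z \<in> P b a \<longleftrightarrow> prod.swap z \<in> P a b"
            using P_swap[of a b "snd z" "fst z"] True by (simp add: prod.swap_def)
          then show ?thesis by (metis image_iff swap_swap)
        qed
        then have "P b a = prod.swap ` P a b" by (rule set_eqI)
        then have "card (P b a) = card (P a b)" by (simp only: card_image[OF inj_swap])
        then show ?thesis using True by (simp add: w_def)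
      qed (auto simp: w_def)
      show "full_pair n H (T a) (T b)" if "w a b = 4" for a b
        proof -
        have ab: "a < m" "b < m" "a \<noteq> b" "card (P a b) = 4" using w[of a b] that by auto
        then have "(2, 2) \<in> P a b" using label_set_cases(2)[OF PC] by blast
        then show ?thesis using P[OF ab(1-3)] by (simp add: full_pair_def)
      qed
      show "free_at_left n H (T a) (T b)" if "3 \<le> w a b" for a b
        proof -
        have ab: "a < m" "b < m" "a \<noteq> b" "3 \<le> card (P a b)" using w[of a b] that by auto
        then have "\<exists>q. (2, q) \<in> P a b" using label_set_cases(3)[OF PC] by blast
        then show ?thesis using P[OF ab(1-3)] by (simp add: free_at_left_def)
      qed
      show "free_at_left n H (T a) (T b) \<or> free_at_left n H (T b) (T a)" if "2 \<le> w a b" for a b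
      proof -
        have ab: "a < m" "b < m" "a \<noteq> b" "2 \<le> card (P a b)" using w[of a b] that by auto
        then have "(\<exists>q. (2, q) \<in> P a b) \<or> (\<exists>q. (2, q) \<in> P b a)"
          using label_set_cases(4)[OF PC[of a b]] P_swap[of a b] by blast
        then show ?thesis using P[OF ab(1-3)] P[OF ab(2,1) ab(3)[symmetric]] by (simp add: free_at_left_def)
      qed
      have "(\<Sum>a<m. \<Sum>b<m. w a b) = (\<Sum>a<m. \<Sum>b<m. if a = b then 0 else card (P a b))"
        by (intro sum.cong refl) (auto simp: w_def)
      then show "c * real m ^ 2 + K * real m < real (\<Sum>a<m. \<Sum>b<m. w a b)" using large by simp
    qed
    then show False using H(2) by simp
  qed
  then show ?thesis by blast
qed

lemma full_edge_in_heavy_triangle: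
  fixes w :: "nat \<Rightarrow> nat \<Rightarrow> nat"
  assumes "\<And>i j. w i j = w j i" "\<And>i. w i i = 0" "\<And>i j. w i j \<le> 4" "6 \<le> p"
    and "real p / 2 * real m ^ 2 < real (\<Sum>a<m. \<Sum>b<m. w a b)"
  obtains i j k where "i < m" "j < m" "k < m" "w i j = 4" "p < w i k + w j k"
proof (rule ccontr)
  assume none: "\<not> thesis"
  have "2 * (\<Sum>a<m. \<Sum>b<m. w a b) \<le> p * card {..<m} ^ 2"
  proof (rule weight_le_if_full_edges_sparse[OF _ assms(1-4)])
    fix i j k assume "i \<in> {..<m}" "j \<in> {..<m}" "k \<in> {..<m}" "w i j = 4"
    then show "w i k + w j k \<le> p" using none that[of i j k] by (meson lessThan_iff not_le)
  qed simp
  then have "real (2 * (\<Sum>a<m. \<Sum>b<m. w a b)) \<le> real (p * m ^ 2)" by (simp only: of_nat_le_iff card_lessThan)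
  then show False using assms(5) unfolding of_nat_mult of_nat_power by simp
qed

text \<open>A third vertex with weights of sum more than \<open>7\<close> to a full edge completes a full triangle, whose
blow-up contains every complete tripartite graph.\<close>

lemma ex_number_less_7_2:
  assumes pos: "1 \<le> r" "1 \<le> s" "1 \<le> t" and "0 < \<epsilon>"
  shows "\<exists>N. \<forall>n\<ge>N. 2 * real (ex_number n (complete_tripartite r s t) 2) < (7 / 2 + \<epsilon>) * real n ^ 2"
proof (rule ex_number_le_of_pattern[where K = 0 and \<tau> = "r + s + t"])
  fix n H m T and w :: "nat \<Rightarrow> nat \<Rightarrow> nat"
  assume T: "\<And>a. a < m \<Longrightarrow> T a \<subseteq> {1..n} \<and> card (T a) = r + s + t"
    and w: "\<And>a b. w a b = w b a" "\<And>a. w a a = 0" "\<And>a b. w a b \<le> 4"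
    and full: "\<And>a b. w a b = 4 \<Longrightarrow> full_pair n H (T a) (T b)"
    and dense: "7 / 2 * real m ^ 2 + 0 * real m < real (\<Sum>a<m. \<Sum>b<m. w a b)"
  obtain i j k where ijk: "i < m" "j < m" "k < m" "w i j = 4" "7 < w i k + w j k"
    by (rule full_edge_in_heavy_triangle[where w = w and p = 7 and m = m]) (use w dense in simp_all)
  then have "w i k = 4" "w j k = 4" using w(3)[of i k] w(3)[of j k] by linarith+
  then show "contains_copy n 3 (complete_tripartite r s t) H"
    using full ijk T[of i] T[of j] T[of k]
    by (intro contains_tripartite_full_triangle[of r s t "T i" n "T j" "T k" H] pos) simp_all
qed (use assms finite_edges[OF simple_graph_complete_tripartite] edges_complete_tripartite_nonempty in auto)

text \<open>A third vertex with weights of sum more than \<open>6\<close> to a full edge gives a triangle of weights \<open>4\<close>, \<open>4\<close>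
and at least \<open>3\<close>.\<close>

lemma ex_number_less_3:
  assumes pos: "1 \<le> r" "1 \<le> s" "1 \<le> t" and rs: "r = 1 \<or> r = 2 \<and> s = 2" and "0 < \<epsilon>"
  shows "\<exists>N. \<forall>n\<ge>N. 2 * real (ex_number n (complete_tripartite r s t) 2) < (3 + \<epsilon>) * real n ^ 2"
proof (rule ex_number_le_of_pattern[where K = 0 and \<tau> = "r + s + t"])
  fix n H m T and w :: "nat \<Rightarrow> nat \<Rightarrow> nat"
  assume T: "\<And>a. a < m \<Longrightarrow> T a \<subseteq> {1..n} \<and> card (T a) = r + s + t"
    and w: "\<And>a b. w a b = w b a" "\<And>a. w a a = 0" "\<And>a b. w a b \<le> 4"
    and full: "\<And>a b. w a b = 4 \<Longrightarrow> full_pair n H (T a) (T b)"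
    and free: "\<And>a b. 3 \<le> w a b \<Longrightarrow> free_at_left n H (T a) (T b)"
    and dense: "3 * real m ^ 2 + 0 * real m < real (\<Sum>a<m. \<Sum>b<m. w a b)"
  obtain i j k where ijk: "i < m" "j < m" "k < m" "w i j = 4" "6 < w i k + w j k"
    by (rule full_edge_in_heavy_triangle[where w = w and p = 6 and m = m]) (use w dense in simp_all)
  have "\<exists>a b c. a < m \<and> b < m \<and> c < m \<and> w a b = 4 \<and> w a c = 4 \<and> 3 \<le> w b c"
  proof (cases "w i k = 4")
    case True
    then have "3 \<le> w j k" using ijk(5) by linarith
    then show ?thesis using ijk True by blast
  next
    case False
    then have "w j k = 4" "3 \<le> w i k" using ijk(5) w(3)[of i k] w(3)[of j k] by linarith+
    then show ?thesis using ijk w(1)[of j i] by metis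
  qed
  then obtain a b c where abc: "a < m" "b < m" "c < m" "w a b = 4" "w a c = 4" "3 \<le> w b c" by blast
  have f: "full_pair n H (T a) (T b)" "full_pair n H (T a) (T c)" "free_at_left n H (T b) (T c)"
    "free_at_left n H (T c) (T b)"
    using full free abc w(1)[of c b] by simp_all
  from rs show "contains_copy n 3 (complete_tripartite r s t) H"
  proof
    assume "r = 1"
    then show ?thesis
      using f T[of a] T[of b] T[of c] abc pos contains_tripartite_1_star[of s t "T a" n "T b" "T c" H] by simp
  next
    assume "r = 2 \<and> s = 2"
    then show ?thesis
      using f T[of a] T[of b] T[of c] abc pos contains_tripartite_2_2[of t "T a" n "T b" "T c" H] by simp
  qed
qed (use assms finite_edges[OF simple_graph_complete_tripartite] edges_complete_tripartite_nonempty in auto)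

text \<open>A pattern of larger weight has a full triangle or a full 4-cycle both of whose diagonals have weight
at least \<open>2\<close>. Each diagonal is free at one of its ends, and the symmetries of the 4-cycle bring these
ends to adjacent positions, as required by \<open>contains_tripartite_full_cycle\<close>.\<close>

lemma ex_number_less_13_4:
  assumes pos: "1 \<le> s" "1 \<le> t" and "0 < \<epsilon>"
  shows "\<exists>N. \<forall>n\<ge>N. 2 * real (ex_number n (complete_tripartite 2 s t) 2) < (13 / 4 + \<epsilon>) * real n ^ 2"
proof (rule ex_number_le_of_pattern[where K = "13 / 4" and \<tau> = "2 + s + t"])
  fix n H m T and w :: "nat \<Rightarrow> nat \<Rightarrow> nat"
  assume T: "\<And>a. a < m \<Longrightarrow> T a \<subseteq> {1..n} \<and> card (T a) = 2 + s + t"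
    and w: "\<And>a b. w a b = w b a" "\<And>a. w a a = 0" "\<And>a b. w a b \<le> 4"
    and full: "\<And>a b. w a b = 4 \<Longrightarrow> full_pair n H (T a) (T b)"
    and free: "\<And>a b. 2 \<le> w a b \<Longrightarrow> free_at_left n H (T a) (T b) \<or> free_at_left n H (T b) (T a)"
    and dense: "13 / 4 * real m ^ 2 + 13 / 4 * real m < real (\<Sum>a<m. \<Sum>b<m. w a b)"
  show "contains_copy n 3 (complete_tripartite 2 s t) H"
  proof (rule ccontr)
    assume no_copy: "\<not> contains_copy n 3 (complete_tripartite 2 s t) H"
    have cycle: "\<not> (free_at_left n H (T i) (T k) \<and> free_at_left n H (T l) (T j))"
      if "i < m" "j < m" "k < m" "l < m" "w i j = 4" "w j k = 4" "w k l = 4" "w l i = 4" for i j k l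
      using no_copy contains_tripartite_full_cycle[of s t "T i" n "T j" "T l" "T k" H] that pos
        T[of i] T[of j] T[of k] T[of l] full[of i j] full[of j k] full[of k l] full[of l i] by auto
    have "4 * (\<Sum>a<m. \<Sum>b<m. w a b) \<le> 13 * card {..<m} ^ 2 + 13 * card {..<m}"
    proof (rule weight_le_if_no_full_cycle[OF _ w])
      fix i j k assume i: "i \<in> {..<m}" "j \<in> {..<m}" "k \<in> {..<m}" "w i j = 4" "w i k = 4"
      show "w j k \<noteq> 4"
      proof
        assume "w j k = 4"
        then have "contains_copy n 3 (complete_tripartite 2 s t) H"
          using full i T[of i] T[of j] T[of k] pos
          by (intro contains_tripartite_full_triangle[of 2 s t "T i" n "T j" "T k" H]) simp_all
        then show False using no_copy by contradiction
      qed
    next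
      fix i j k l
      assume i: "i \<in> {..<m}" "j \<in> {..<m}" "k \<in> {..<m}" "l \<in> {..<m}"
        "w i j = 4" "w j k = 4" "w k l = 4" "w l i = 4" "2 \<le> w i k"
      show "w j l \<le> 1"
      proof (rule ccontr)
        assume "\<not> w j l \<le> 1"
        then have "free_at_left n H (T j) (T l) \<or> free_at_left n H (T l) (T j)" by (intro free) simp
        moreover have "free_at_left n H (T i) (T k) \<or> free_at_left n H (T k) (T i)" by (intro free i(9))
        moreover have "w j i = 4" "w k j = 4" "w l k = 4" "w i l = 4" using i w(1) by metis+
        ultimately show False
          using cycle[of i j k l] cycle[of k j i l] cycle[of i l k j] cycle[of k l i j] i by auto
      qed
    qed simp
    then have "real (4 * (\<Sum>a<m. \<Sum>b<m. w a b)) \<le> real (13 * m ^ 2 + 13 * m)"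
      by (simp only: of_nat_le_iff card_lessThan)
    then show False using dense unfolding of_nat_mult of_nat_add of_nat_power by simp
  qed
qed (use assms finite_edges[OF simple_graph_complete_tripartite] edges_complete_tripartite_nonempty in auto)

section \<open>Asymptotics\<close>

text \<open>Twice the extremal number is compared with \<open>n ^ 2\<close> in the upper bounds and with \<open>n * (n - 1)\<close> in the
lower ones; the difference and the linear error term are both of lower order.\<close>

lemma asymptotics_of_bounds:
  fixes f :: "nat \<Rightarrow> nat" and c :: real
  assumes lower: "\<And>n. c * (real n * (real n - 1)) - 23 * real n \<le> 2 * real (f n)"
    and upper: "\<And>\<epsilon>. 0 < \<epsilon> \<Longrightarrow> \<exists>N. \<forall>n\<ge>N. 2 * real (f n) < (c + \<epsilon>) * real n ^ 2"
  shows "\<exists>\<epsilon> :: nat \<Rightarrow> real. \<epsilon> \<in> o(\<lambda>_. 1) \<and>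
    (\<forall>\<^sub>F n in sequentially. real (f n) = (c + \<epsilon> n) * real (n choose 2))"
proof -
  define \<epsilon> where "\<epsilon> n = real (f n) / real (n choose 2) - c" for n
  have choose: "real (n choose 2) = real n * (real n - 1) / 2" if "2 \<le> n" for n
  proof -
    have "even (n * (n - 1))" by (cases n) auto
    then have "real (n * (n - 1) div 2) = real (n * (n - 1)) / 2" by (simp add: real_of_nat_div)
    then show ?thesis using that by (simp add: choose_two of_nat_diff)
  qed
  have "\<exists>N. \<forall>n\<ge>N. norm (\<epsilon> n - 0) < \<eta>" if \<eta>: "0 < \<eta>" for \<eta>
  proof -
    obtain N where N: "\<And>n. N \<le> n \<Longrightarrow> 2 * real (f n) < (c + \<eta> / 2) * real n ^ 2"
      using upper[OF half_gt_zero[OF \<eta>]] by blast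
    define M where "M = max N (max 2 (max (nat \<lceil>2 * (c + \<eta>) / \<eta>\<rceil>) (nat \<lceil>23 / \<eta>\<rceil> + 2)))"
    have "norm (\<epsilon> n - 0) < \<eta>" if "M \<le> n" for n
    proof -
      have n: "N \<le> n" "2 \<le> n" "2 * (c + \<eta>) / \<eta> \<le> real n" "23 / \<eta> < real n - 1"
        using that unfolding M_def by linarith+
      have n': "c + \<eta> \<le> \<eta> / 2 * real n" "23 < \<eta> * (real n - 1)"
        using n(3,4) \<open>0 < \<eta>\<close> by (simp_all add: field_simps)
      have pos: "0 < real n * (real n - 1)" using n(2) by simp
      have "(c + \<eta> / 2) * real n \<le> (c + \<eta>) * (real n - 1)" using n'(1) by (simp add: algebra_simps)
      then have "real n * ((c + \<eta> / 2) * real n) \<le> real n * ((c + \<eta>) * (real n - 1))"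
        by (intro mult_left_mono) auto
      then have up: "2 * real (f n) < (c + \<eta>) * (real n * (real n - 1))"
        using N[OF n(1)] by (simp add: power2_eq_square mult_ac)
      have "real n * 23 < real n * (\<eta> * (real n - 1))" using n'(2) n(2) by (intro mult_strict_left_mono) auto
      then have lo: "(c - \<eta>) * (real n * (real n - 1)) < 2 * real (f n)"
        using lower[of n] by (simp add: algebra_simps)
      have "\<epsilon> n = 2 * real (f n) / (real n * (real n - 1)) - c"
        by (simp add: \<epsilon>_def choose[OF n(2)])
      moreover have "2 * real (f n) / (real n * (real n - 1)) < c + \<eta>"
        using up pos by (simp only: pos_divide_less_eq)
      moreover have "c - \<eta> < 2 * real (f n) / (real n * (real n - 1))"
        using lo pos by (simp only: pos_less_divide_eq)
      ultimately show ?thesis by (simp add: abs_less_iff)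
    qed
    then show ?thesis by blast
  qed
  then have "\<epsilon> \<longlonglongrightarrow> 0" by (rule LIMSEQ_I)
  then have "\<epsilon> \<in> o(\<lambda>_. 1)" by (intro smalloI_tendsto) simp_all
  moreover have "\<forall>\<^sub>F n in sequentially. real (f n) = (c + \<epsilon> n) * real (n choose 2)"
    using eventually_ge_at_top[of 2]
  proof eventually_elim
    case (elim n)
    then have "real (n choose 2) \<noteq> 0" by (simp add: choose)
    then show ?case by (simp add: \<epsilon>_def)
  qed
  ultimately show ?thesis by blast
qed

theorem theorem1p11:
  fixes r s t :: nat
  assumes "1 \<le> r" and "r \<le> s" and "s \<le> t" and "t \<ge> 2"
  shows "(r = 1 \<or> s \<le> 2 \<longrightarrow>
           (\<exists>\<epsilon> :: nat \<Rightarrow> real. \<epsilon> \<in> o(\<lambda>_. 1) \<and>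
             (\<forall>\<^sub>F n in sequentially.
               real (ex_number n (complete_tripartite r s t) 2) = (3 + \<epsilon> n) * real (n choose 2)))) \<and>
         (r = 2 \<and> s \<ge> 3 \<longrightarrow>
           (\<exists>\<epsilon> :: nat \<Rightarrow> real. \<epsilon> \<in> o(\<lambda>_. 1) \<and>
             (\<forall>\<^sub>F n in sequentially.
               real (ex_number n (complete_tripartite r s t) 2) = (13 / 4 + \<epsilon> n) * real (n choose 2)))) \<and>
         (r \<ge> 3 \<longrightarrow>
           (\<exists>\<epsilon> :: nat \<Rightarrow> real. \<epsilon> \<in> o(\<lambda>_. 1) \<and>
             (\<forall>\<^sub>F n in sequentially.
               real (ex_number n (complete_tripartite r s t) 2) = (7 / 2 + \<epsilon> n) * real (n choose 2))))"
proof (intro conjI impI)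
  have pos: "1 \<le> s" "1 \<le> t" using assms by simp_all
  show "\<exists>\<epsilon> :: nat \<Rightarrow> real. \<epsilon> \<in> o(\<lambda>_. 1) \<and> (\<forall>\<^sub>F n in sequentially.
      real (ex_number n (complete_tripartite r s t) 2) = (3 + \<epsilon> n) * real (n choose 2))"
    if "r = 1 \<or> s \<le> 2"
  proof (rule asymptotics_of_bounds)
    have "3 * (real n * (real n - 1)) \<le> 2 * real (ex_number n (complete_tripartite r s t) 2)" for n
    proof -
      have "real (3 * (n * (n - 1))) \<le> real (2 * ex_number n (complete_tripartite r s t) 2)"
        using ex_number_ge_3[OF assms(1) pos(1) assms(4)] by (simp only: of_nat_le_iff)
      moreover have "real (n * (n - 1)) = real n * (real n - 1)" by (cases n) (simp_all add: algebra_simps)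
      ultimately show ?thesis by (simp only: of_nat_mult[of 3] of_nat_mult[of 2] of_nat_numeral)
    qed
    then show "3 * (real n * (real n - 1)) - 23 * real n \<le> 2 * real (ex_number n (complete_tripartite r s t) 2)" for n
      by (smt (verit) of_nat_0_le_iff)
    have "r = 1 \<or> r = 2 \<and> s = 2" using that assms by linarith
    then show "\<exists>N. \<forall>n\<ge>N. 2 * real (ex_number n (complete_tripartite r s t) 2) < (3 + \<epsilon>) * real n ^ 2"
      if "0 < \<epsilon>" for \<epsilon> using ex_number_less_3 assms(1) pos that by blast
  qed
  show "\<exists>\<epsilon> :: nat \<Rightarrow> real. \<epsilon> \<in> o(\<lambda>_. 1) \<and> (\<forall>\<^sub>F n in sequentially.
      real (ex_number n (complete_tripartite r s t) 2) = (13 / 4 + \<epsilon> n) * real (n choose 2))"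
    if "r = 2 \<and> 3 \<le> s"
    using that assms pos ex_number_ge_13_4[of r s t] ex_number_less_13_4[of s t]
    by (intro asymptotics_of_bounds) auto
  show "\<exists>\<epsilon> :: nat \<Rightarrow> real. \<epsilon> \<in> o(\<lambda>_. 1) \<and> (\<forall>\<^sub>F n in sequentially.
      real (ex_number n (complete_tripartite r s t) 2) = (7 / 2 + \<epsilon> n) * real (n choose 2))"
    if "3 \<le> r"
    using that assms pos ex_number_ge_7_2[of r s t] ex_number_less_7_2[of r s t]
    by (intro asymptotics_of_bounds) auto
qed

end
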